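(* For $j\in\{\tfrac12,1,\tfrac32,2,\tfrac52,3,\tfrac72,4\}$ let $J_X,J_Y$ be the angular momentum operators with total angular momentum quantum number $j$, acting on $\mathbb{C}^{2j+1}$, and let $$c_j=\min_{\rho\in\mathcal{M}_{2j+1}}\left(\Delta^2(J_X)_\rho+\Delta^2(J_Y)_\rho\right).$$ Then $P_j(c_j)=0$, where the polynomials $P_j$ are: $P_{1/2}(\lambda)=4\lambda-1$; $P_1(\lambda)=16\lambda-7$; $P_{3/2}(\lambda)=64\lambda^3-336\lambda^2+480\lambda-181$; $P_2(\lambda)=1024\lambda^3-7104\lambda^2+13404\lambda-6487$; $P_{5/2}(\lambda)=4194304\lambda^7-117440512\lambda^6+1323466752\lambda^5-7743660032\lambda^4+25301870144\lambda^3-45976348848\lambda^2+42609045676\lambda-15158613241$; $P_3(\lambda)=262144\lambda^6-8159232\lambda^5+98042880\lambda^4-574842880\lambda^3+1709341632\lambda^2-2397898539\lambda+1179352998$; $P_{7/2}(\lambda)=8589934592\lambda^{13}-807453851648\lambda^{12}+33978291585024\lambda^{11}-846111845646336\lambda^{10}+13886438674268160\lambda^9-158338610153127936\lambda^8+1288197712964943872\lambda^7-7558113438967267328\lambda^6+31923050400995246592\lambda^5-95672589723220763904\lambda^4+197231954550318498240\lambda^3-263781099083569171968\lambda^2+203719751641654010210\lambda-67745907126251250695$; $P_4(\lambda)=268435456\lambda^{10}-24326963200\lambda^9+952177262592\lambda^8-21110360768512\lambda^7+292217512296448\lambda^6-2624974965550080\lambda^5+15404738985045728\lambda^4-57914832267046937\lambda^3+132277607024648928\lambda^2-163205035294297553\lambda+79926677043771116$.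 The values are $c_{1/2}=\tfrac14$, $c_1=\tfrac7{16}$, $c_{3/2}\approx0.6009$, $c_2\approx0.7496$, $c_{5/2}\approx0.8877$, $c_3\approx1.018$, $c_{7/2}\approx1.142$, $c_4\approx1.260$ (approximations to four significant digits). Moreover each $P_j$ is minimal: no nonzero polynomial with integer coefficients of degree lower than $\deg P_j$ has $c_j$ as a root.
   Context: $\mathcal{M}_d=\{\rho:\rho^\dagger=\rho\ge 0,\ \mathrm{Tr}\,\rho=1\}$ is the set of density matrices (mixed states) of size $d$. For a Hermitian operator $F$ and $\rho\in\mathcal{M}_d$, $\langle F\rangle_\rho=\mathrm{Tr}(\rho F)$, and $\Delta^2F_\rho=\langle F^2\rangle_\rho-\langle F\rangle_\rho^2$. The angular momentum operators for quantum number $j$ (with $\hbar=1$) are the Hermitian generators of the $(2j+1)$-dimensional irreducible representation of $\mathfrak{su}(2)$: in an orthonormal basis $|m\rangle$, $m=-j,-j+1,\dots,j$, one has $J_X=\tfrac12(J_++J_-)$ and $J_Y=\tfrac1{2i}(J_+-J_-)$, where $J_\pm|m\rangle=\sqrt{j(j+1)-m(m\pm1)}\,|m\pm1\rangle$ (interpreted as $0$ when the coefficient vanishes). *)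

theory Defs
  imports Complex_Main "Jordan_Normal_Form.Schur_Decomposition"
begin

definition mat_trace :: "complex mat \<Rightarrow> complex" where
  "mat_trace A = (\<Sum>i<dim_row A. A $$ (i, i))"

(* The order on complex numbers is "Re x \<le> Re y and Im x = Im y". *)
definition density_matrices :: "nat \<Rightarrow> complex mat set" where
  "density_matrices d =
     {\<rho> \<in> carrier_mat d d. mat_adjoint \<rho> = \<rho> \<and>
        (\<forall>v\<in>carrier_vec d. 0 \<le> (\<rho> *\<^sub>v v) \<bullet>c v) \<and> mat_trace \<rho> = 1}"

(* For Hermitian \<rho> and F the trace is real, so taking Re only changes the type. *)
definition expectation :: "complex mat \<Rightarrow> complex mat \<Rightarrow> real" where
  "expectation \<rho> F = Re (mat_trace (\<rho> * F))"

definition variance :: "complex mat \<Rightarrow> complex mat \<Rightarrow> real" where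
  "variance \<rho> F = expectation \<rho> (F * F) - (expectation \<rho> F)\<^sup>2"

(* The half-integer j is encoded by the natural number N = 2j, so that the dimension
   2j + 1 is Suc N. Row and column index k = 0, ..., N stands for the basis vector with
   m = k - j. *)

definition spin :: "nat \<Rightarrow> real" where
  "spin N = real N / 2"

definition magnetic :: "nat \<Rightarrow> nat \<Rightarrow> real" where
  "magnetic N k = real k - spin N"

definition J_plus :: "nat \<Rightarrow> complex mat" where
  "J_plus N = mat (Suc N) (Suc N) (\<lambda>(r, c).
     if r = Suc c
     then complex_of_real (sqrt (spin N * (spin N + 1) - magnetic N c * (magnetic N c + 1)))
     else 0)"

definition J_minus :: "nat \<Rightarrow> complex mat" where
  "J_minus N = mat (Suc N) (Suc N) (\<lambda>(r, c).
     if Suc r = c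
     then complex_of_real (sqrt (spin N * (spin N + 1) - magnetic N c * (magnetic N c - 1)))
     else 0)"

definition J_X :: "nat \<Rightarrow> complex mat" where
  "J_X N = (1 / 2) \<cdot>\<^sub>m (J_plus N + J_minus N)"

definition J_Y :: "nat \<Rightarrow> complex mat" where
  "J_Y N = (1 / (2 * \<i>)) \<cdot>\<^sub>m (J_plus N - J_minus N)"

definition variance_sum :: "nat \<Rightarrow> complex mat \<Rightarrow> real" where
  "variance_sum N \<rho> = variance \<rho> (J_X N) + variance \<rho> (J_Y N)"

(* Inf agrees with the minimum only if it is attained; state attainment where it matters. *)
definition min_variance_sum :: "nat \<Rightarrow> real" where
  "min_variance_sum N = (INF \<rho>\<in>density_matrices (Suc N). variance_sum N \<rho>)"

(* Coefficients are listed from the constant term upwards; again N = 2j. *)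
definition spin_poly :: "nat \<Rightarrow> int poly" where
  "spin_poly N = (
    if N = 1 then
      [:-1, 4:]
    else if N = 2 then
      [:-7, 16:]
    else if N = 3 then
      [:-181, 480, -336, 64:]
    else if N = 4 then
      [:-6487, 13404, -7104, 1024:]
    else if N = 5 then
      [:-15158613241, 42609045676, -45976348848, 25301870144, -7743660032,
        1323466752, -117440512, 4194304:]
    else if N = 6 then
      [:1179352998, -2397898539, 1709341632, -574842880, 98042880, -8159232,
        262144:]
    else if N = 7 then
      [:-67745907126251250695, 203719751641654010210, -263781099083569171968,
        197231954550318498240, -95672589723220763904, 31923050400995246592,
        -7558113438967267328, 1288197712964943872, -158338610153127936,
        13886438674268160, -846111845646336, 33978291585024, -807453851648,
        8589934592:]
    else if N = 8 then
      [:79926677043771116, -163205035294297553, 132277607024648928,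
        -57914832267046937, 15404738985045728, -2624974965550080,
        292217512296448, -21110360768512, 952177262592, -24326963200,
        268435456:]
    else 0)"

end

theory Submission
  imports Defs "HOL-Analysis.Function_Topology" "HOL-Number_Theory.Pocklington"
begin

text \<open>
  Since \<open>J_X\<^sup>2 + J_Y\<^sup>2\<close> is diagonal and \<open>J_X\<close>, \<open>J_Y\<close> only couple neighbouring basis vectors, replacing
  \<open>\<rho>\<close> by the pure state with amplitudes \<open>sqrt (\<rho> k k)\<close> does not increase the variance sum; so it
  suffices to minimise over nonnegative real unit vectors, and \<open>c\<close> is attained by compactness.
  Completing the square, \<open>c\<close> is the minimum over \<open>s\<close> of the least eigenvalue of the tridiagonal matrix
  \<open>J_X\<^sup>2 + J_Y\<^sup>2 - 2 s J_X + s\<^sup>2\<close>. Its ground state is symmetric under \<open>m \<mapsto> - m\<close>, and the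
  determinant of the matrix minus \<open>c\<close> on the symmetric sector, as a polynomial in \<open>s\<close>, has a double
  root at the optimal \<open>s\<close>. Hence its discriminant vanishes at \<open>c\<close>; this discriminant is \<open>P_j\<close> up to a
  factor without roots in the relevant range. The enclosures follow because \<open>c\<close> is the smallest real
  root of \<open>P_j\<close>, and minimality because \<open>P_j\<close> is irreducible, by a large prime value of \<open>P_j\<close>.
\<close>

section \<open>Reduction to nonnegative pure states\<close>

text \<open>No eigenvalue or eigenvector is computed. For \<open>s \<noteq> 0\<close> the three-term
  recurrence, solved from \<open>k = 0\<close> to the middle and continued by reflection, gives a
  test vector that violates only the middle equations. Up to a positive factor the quadratic form
  takes on it the value minor times secular polynomial. Nonnegativity of the form makes this product
  nonnegative in \<open>s\<close>; it vanishes at the optimal \<open>s\<close>, and a local minimum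
  with value 0 is what produces the double root. The same inequality gives the upper bounds: one
  rational pair \<open>(l, s)\<close> with negative product puts the minimum below \<open>l\<close>.
  Test vectors give no lower bounds, so these come from the absence of roots of \<open>P_j\<close>
  up to a rational just below the minimum. The extra factor of the discriminant for odd
  \<open>2 j\<close> stems from double roots at \<open>s = 0\<close>: they occur when the eigenvalue
  variable equals an entry \<open>j (j + 1) - m^2\<close> of the diagonal outside the middle, and
  all of these are at least \<open>j\<close>.\<close>

definition ladder :: "nat \<Rightarrow> nat \<Rightarrow> real" where
  "ladder N k = sqrt ((real k + 1) * (real N - real k))"

text \<open>The eigenvalue \<open>j (j + 1) - m^2\<close> of
  \<open>J_X\<^sup>2 + J_Y\<^sup>2\<close>, kept as half the sum of the squared couplings to both
  neighbours, the form in which the matrix product delivers it.\<close>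

definition diag_coeff :: "nat \<Rightarrow> nat \<Rightarrow> real" where
  "diag_coeff N k = (real k * (real N + 1 - real k) + (real k + 1) * (real N - real k)) / 2"

definition ladder_entry :: "nat \<Rightarrow> nat \<Rightarrow> nat \<Rightarrow> complex" where
  "ladder_entry N r c = (if r = Suc c then complex_of_real (ladder N c) else 0)"

lemma J_plus_eq: "J_plus N = mat (Suc N) (Suc N) (\<lambda>(r, c). ladder_entry N r c)"
  by (rule eq_matI)
     (auto simp: J_plus_def ladder_entry_def ladder_def spin_def magnetic_def field_simps)

lemma J_minus_eq: "J_minus N = mat (Suc N) (Suc N) (\<lambda>(r, c). ladder_entry N c r)"
  by (rule eq_matI)
     (auto simp: J_minus_def ladder_entry_def ladder_def spin_def magnetic_def field_simps)

lemma J_X_eq: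
  "J_X N = mat (Suc N) (Suc N) (\<lambda>(r, c). (ladder_entry N r c + ladder_entry N c r) / 2)"
  by (rule eq_matI) (auto simp: J_X_def J_plus_eq J_minus_eq)

lemma J_Y_eq:
  "J_Y N = mat (Suc N) (Suc N) (\<lambda>(r, c). (ladder_entry N r c - ladder_entry N c r) / (2 * \<i>))"
  by (rule eq_matI) (auto simp: J_Y_def J_plus_eq J_minus_eq)

lemma mat_trace_mult_mat:
  assumes "\<rho> \<in> carrier_mat n n"
  shows "mat_trace (\<rho> * mat n n (\<lambda>(r, c). f r c)) = (\<Sum>i<n. \<Sum>l<n. \<rho> $$ (i, l) * f l i)"
  using assms
  by (auto simp: mat_trace_def scalar_prod_def lessThan_atLeast0 intro!: sum.cong)

lemma ladder_sq: "k \<le> N \<Longrightarrow> (ladder N k)\<^sup>2 = (real k + 1) * (real N - real k)"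
  by (simp add: ladder_def)

text \<open>The left side is an entry of \<open>J_plus N * J_minus N + J_minus N * J_plus N\<close>:
  one step up and one step down return to the start.\<close>

lemma sum_ladder_entry_squares:
  assumes "r \<le> N" "c \<le> N"
  shows "(\<Sum>m<Suc N. ladder_entry N r m * ladder_entry N c m + ladder_entry N m r * ladder_entry N m c)
    = (if r = c then complex_of_real (2 * diag_coeff N r) else 0)"
proof (cases "r = c")
  case False
  have "ladder_entry N r m * ladder_entry N c m + ladder_entry N m r * ladder_entry N m c = 0" for m
    using False by (auto simp: ladder_entry_def)
  then show ?thesis using False by simp
next
  case True
  have 1: "(\<Sum>m<Suc N. ladder_entry N r m * ladder_entry N r m) = complex_of_real (real r * (real N + 1 - real r))"
  proof (cases r)
    case 0
    then show ?thesis by (simp add: ladder_entry_def)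
  next
    case (Suc k)
    have "(\<Sum>m<Suc N. ladder_entry N r m * ladder_entry N r m)
        = (\<Sum>m<Suc N. if m = k then complex_of_real ((ladder N k)\<^sup>2) else 0)"
      by (intro sum.cong) (auto simp: ladder_entry_def Suc power2_eq_square)
    also have "\<dots> = complex_of_real ((ladder N k)\<^sup>2)"
      using Suc assms by (simp add: sum.delta)
    finally show ?thesis using Suc assms by (simp add: ladder_sq)
  qed
  have 2: "(\<Sum>m<Suc N. ladder_entry N m r * ladder_entry N m r)
    = complex_of_real ((real r + 1) * (real N - real r))"
  proof -
    have "(\<Sum>m<Suc N. ladder_entry N m r * ladder_entry N m r)
        = (\<Sum>m<Suc N. if m = Suc r then complex_of_real ((ladder N r)\<^sup>2) else 0)"
      by (intro sum.cong) (auto simp: ladder_entry_def power2_eq_square)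
    \<comment> \<open>For \<open>r = N\<close> the index \<open>Suc r\<close> is out of range, in
      agreement with the factor \<open>real N - real r = 0\<close> of the claim.\<close>
    also have "\<dots> = (if r < N then complex_of_real ((ladder N r)\<^sup>2) else 0)"
      by (subst sum.delta) auto
    finally show ?thesis using assms by (auto simp: ladder_sq not_less)
  qed
  show ?thesis
    using 1 2 True by (simp add: sum.distrib diag_coeff_def)
qed

text \<open>The squares of \<open>J_plus\<close> and \<open>J_minus\<close> cancel because of the
  factor \<open>1 / \<i>\<close> in \<open>J_Y\<close>; only the two mixed products remain.\<close>

lemma expectation_mult_eq:
  assumes "\<rho> \<in> carrier_mat (Suc N) (Suc N)"
  shows "expectation \<rho> (J_X N * J_X N) + expectation \<rho> (J_Y N * J_Y N)
    = (\<Sum>k\<le>N. diag_coeff N k * Re (\<rho> $$ (k, k)))"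
proof -
  let ?e = "ladder_entry N"
  have X: "J_X N * J_X N = mat (Suc N) (Suc N) (\<lambda>(r, c). \<Sum>m<Suc N.
      (?e r m + ?e m r) / 2 * ((?e m c + ?e c m) / 2))"
    unfolding J_X_eq by (rule eq_matI) (auto simp: scalar_prod_def lessThan_atLeast0 intro!: sum.cong)
  have Y: "J_Y N * J_Y N = mat (Suc N) (Suc N) (\<lambda>(r, c). \<Sum>m<Suc N.
      (?e r m - ?e m r) / (2 * \<i>) * ((?e m c - ?e c m) / (2 * \<i>)))"
    unfolding J_Y_eq by (rule eq_matI) (auto simp: scalar_prod_def lessThan_atLeast0 intro!: sum.cong)
  have XY: "(\<Sum>m<Suc N. (?e r m + ?e m r) / 2 * ((?e m c + ?e c m) / 2))
     + (\<Sum>m<Suc N. (?e r m - ?e m r) / (2 * \<i>) * ((?e m c - ?e c m) / (2 * \<i>)))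
     = (if r = c then complex_of_real (diag_coeff N r) else 0)" if "r \<le> N" "c \<le> N" for r c
  proof -
    have "(?e r m + ?e m r) / 2 * ((?e m c + ?e c m) / 2)
       + (?e r m - ?e m r) / (2 * \<i>) * ((?e m c - ?e c m) / (2 * \<i>))
       = (?e r m * ?e c m + ?e m r * ?e m c) / 2" for m
      by (simp add: field_simps)
    then have "(\<Sum>m<Suc N. (?e r m + ?e m r) / 2 * ((?e m c + ?e c m) / 2))
     + (\<Sum>m<Suc N. (?e r m - ?e m r) / (2 * \<i>) * ((?e m c - ?e c m) / (2 * \<i>)))
      = (\<Sum>m<Suc N. ?e r m * ?e c m + ?e m r * ?e m c) / 2"
      by (simp only: sum.distrib [symmetric] sum_divide_distrib)
    also have "\<dots> = (if r = c then complex_of_real (diag_coeff N r) else 0)"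
      unfolding sum_ladder_entry_squares [OF that] by simp
    finally show ?thesis .
  qed
  have "mat_trace (\<rho> * (J_X N * J_X N)) + mat_trace (\<rho> * (J_Y N * J_Y N))
    = (\<Sum>i<Suc N. \<Sum>l<Suc N. \<rho> $$ (i, l) * (if l = i then complex_of_real (diag_coeff N l) else 0))"
    unfolding X Y mat_trace_mult_mat [OF assms] sum.distrib [symmetric] distrib_left [symmetric]
    by (intro sum.cong refl, subst XY [unfolded sum.distrib [symmetric]]) (auto simp del: sum.lessThan_Suc)
  also have "\<dots> = (\<Sum>i<Suc N. \<rho> $$ (i, i) * complex_of_real (diag_coeff N i))"
    by (intro sum.cong refl) (simp add: sum.delta if_distrib [of "\<lambda>x. _ * x"] cong: if_cong)
  finally have "Re (mat_trace (\<rho> * (J_X N * J_X N)) + mat_trace (\<rho> * (J_Y N * J_Y N)))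
    = (\<Sum>i<Suc N. diag_coeff N i * Re (\<rho> $$ (i, i)))"
    by (simp add: mult.commute)
  then show ?thesis
    by (simp add: expectation_def lessThan_Suc_atMost)
qed

lemma sum_mult_ladder_entry:
  "(\<Sum>i<Suc N. \<Sum>l<Suc N. g i l * ladder_entry N i l) = (\<Sum>k<N. complex_of_real (ladder N k) * g (Suc k) k)"
proof -
  have "(\<Sum>i<Suc N. \<Sum>l<Suc N. g i l * ladder_entry N i l)
     = (\<Sum>l<Suc N. \<Sum>i<Suc N. if i = Suc l then complex_of_real (ladder N l) * g (Suc l) l else 0)"
    by (subst sum.swap) (intro sum.cong, auto simp: ladder_entry_def)
  also have "\<dots> = (\<Sum>l<Suc N. if l < N then complex_of_real (ladder N l) * g (Suc l) l else 0)"
    by (intro sum.cong refl, subst sum.delta) auto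
  also have "\<dots> = (\<Sum>k<N. complex_of_real (ladder N k) * g (Suc k) k)"
    by simp
  finally show ?thesis .
qed

lemma mat_adjoint_entry:
  fixes \<rho> :: "complex mat"
  assumes "\<rho> \<in> carrier_mat n n" "i < n" "j < n"
  shows "mat_adjoint \<rho> $$ (j, i) = cnj (\<rho> $$ (i, j))"
  using assms by (simp add: mat_adjoint_def mat_of_rows_def)

lemma hermitian_entry:
  fixes \<rho> :: "complex mat"
  assumes "\<rho> \<in> carrier_mat n n" "mat_adjoint \<rho> = \<rho>" "i < n" "j < n"
  shows "\<rho> $$ (j, i) = cnj (\<rho> $$ (i, j))"
  using mat_adjoint_entry [OF assms(1,3,4)] assms(2) by simp

text \<open>The sum on the right is the expectation of \<open>J_minus N\<close>, which is
  \<open>J_X - \<i> J_Y\<close>; its real and imaginary parts are the two expectations up to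
  sign.\<close>

lemma expectation_squares_eq:
  assumes "\<rho> \<in> carrier_mat (Suc N) (Suc N)" "mat_adjoint \<rho> = \<rho>"
  shows "(expectation \<rho> (J_X N))\<^sup>2 + (expectation \<rho> (J_Y N))\<^sup>2
    = (cmod (\<Sum>k<N. complex_of_real (ladder N k) * \<rho> $$ (Suc k, k)))\<^sup>2"
proof -
  define z where "z = (\<Sum>k<N. complex_of_real (ladder N k) * \<rho> $$ (Suc k, k))"
  let ?e = "ladder_entry N"
  have 1: "(\<Sum>i<Suc N. \<Sum>l<Suc N. \<rho> $$ (i, l) * ?e i l) = z"
    unfolding z_def by (rule sum_mult_ladder_entry)
  have "(\<Sum>i<Suc N. \<Sum>l<Suc N. \<rho> $$ (i, l) * ?e l i) = (\<Sum>i<Suc N. \<Sum>l<Suc N. \<rho> $$ (l, i) * ?e i l)"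
    by (rule sum.swap)
  also have "\<dots> = (\<Sum>k<N. complex_of_real (ladder N k) * \<rho> $$ (k, Suc k))"
    by (rule sum_mult_ladder_entry)
  also have "\<dots> = cnj z"
    unfolding z_def cnj_sum complex_cnj_mult complex_cnj_complex_of_real
    by (intro sum.cong refl arg_cong2 [where f = "(*)"] hermitian_entry [OF assms]) auto
  finally have 2: "(\<Sum>i<Suc N. \<Sum>l<Suc N. \<rho> $$ (i, l) * ?e l i) = cnj z" .
  have "mat_trace (\<rho> * J_X N) = (\<Sum>i<Suc N. \<Sum>l<Suc N. (\<rho> $$ (i, l) * ?e l i + \<rho> $$ (i, l) * ?e i l) / 2)"
    unfolding J_X_eq mat_trace_mult_mat [OF assms(1)] by (simp add: algebra_simps)
  also have "\<dots> = (cnj z + z) / 2"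
    by (simp only: sum_divide_distrib [symmetric] sum.distrib 1 2)
  also have "\<dots> = complex_of_real (Re z)"
    by (simp add: complex_eq_iff)
  finally have X: "expectation \<rho> (J_X N) = Re z"
    by (simp add: expectation_def)
  have "mat_trace (\<rho> * J_Y N) = (\<Sum>i<Suc N. \<Sum>l<Suc N. (\<rho> $$ (i, l) * ?e l i - \<rho> $$ (i, l) * ?e i l) / (2 * \<i>))"
    unfolding J_Y_eq mat_trace_mult_mat [OF assms(1)] by (simp add: algebra_simps)
  also have "\<dots> = (cnj z - z) / (2 * \<i>)"
    by (simp only: sum_divide_distrib [symmetric] sum_subtractf 1 2)
  also have "\<dots> = complex_of_real (- Im z)"
    by (simp add: complex_eq_iff)
  finally have Y: "expectation \<rho> (J_Y N) = - Im z"
    by (simp add: expectation_def)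
  show ?thesis
    unfolding X Y z_def [symmetric] by (simp add: cmod_def)
qed

lemma variance_sum_eq:
  assumes "\<rho> \<in> carrier_mat (Suc N) (Suc N)" "mat_adjoint \<rho> = \<rho>"
  shows "variance_sum N \<rho> = (\<Sum>k\<le>N. diag_coeff N k * Re (\<rho> $$ (k, k)))
    - (cmod (\<Sum>k<N. complex_of_real (ladder N k) * \<rho> $$ (Suc k, k)))\<^sup>2"
  using expectation_mult_eq [OF assms(1)] expectation_squares_eq [OF assms]
  by (simp add: variance_sum_def variance_def)

section \<open>Comparison of density matrices with nonnegative pure states\<close>

definition pure_variance :: "nat \<Rightarrow> (nat \<Rightarrow> real) \<Rightarrow> real" where
  "pure_variance N v = (\<Sum>k\<le>N. diag_coeff N k * (v k)\<^sup>2) - (\<Sum>k<N. ladder N k * v k * v (Suc k))\<^sup>2"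

lemma ladder_nonneg: "0 \<le> ladder N k" if "k \<le> N"
  using that by (simp add: ladder_def)

lemma psd_quadratic_form:
  fixes \<rho> :: "complex mat"
  assumes \<rho>: "\<rho> \<in> carrier_mat n n" and psd: "\<forall>v\<in>carrier_vec n. 0 \<le> (\<rho> *\<^sub>v v) \<bullet>c v"
  shows "0 \<le> Re (\<Sum>i<n. \<Sum>j<n. \<rho> $$ (i, j) * f j * cnj (f i))"
proof -
  have "0 \<le> (\<rho> *\<^sub>v vec n f) \<bullet>c vec n f" using psd by simp
  also have "(\<rho> *\<^sub>v vec n f) \<bullet>c vec n f = (\<Sum>i<n. \<Sum>j<n. \<rho> $$ (i, j) * f j * cnj (f i))"
    using \<rho> by (auto simp: scalar_prod_def lessThan_atLeast0 sum_distrib_right intro!: sum.cong)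
  finally show ?thesis by (simp add: less_eq_complex_def)
qed

text \<open>Nonnegativity of a principal minor of size 2, obtained from the form on vectors
  supported on \<open>{i, j}\<close>.\<close>

lemma density_offdiagonal_bound:
  assumes "\<rho> \<in> density_matrices n" "i < n" "j < n" "i \<noteq> j"
  shows "cmod (\<rho> $$ (i, j)) \<le> sqrt (Re (\<rho> $$ (i, i))) * sqrt (Re (\<rho> $$ (j, j)))"
proof -
  have \<rho>: "\<rho> \<in> carrier_mat n n" "mat_adjoint \<rho> = \<rho>"
    and psd: "\<forall>v\<in>carrier_vec n. 0 \<le> (\<rho> *\<^sub>v v) \<bullet>c v"
    using assms(1) by (auto simp: density_matrices_def)
  define a b g where "a = Re (\<rho> $$ (i, i))" and "b = Re (\<rho> $$ (j, j))" and "g = \<rho> $$ (i, j)"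
  have g': "\<rho> $$ (j, i) = cnj g"
    unfolding g_def using hermitian_entry [OF \<rho> assms(2,3)] .
  have diag: "\<rho> $$ (k, k) = complex_of_real (Re (\<rho> $$ (k, k)))" if "k < n" for k
    using hermitian_entry [OF \<rho> that that] by (simp add: complex_eq_iff)
  have form: "0 \<le> Re (\<rho> $$ (i, i) * x * cnj x + g * y * cnj x + cnj g * x * cnj y + \<rho> $$ (j, j) * y * cnj y)"
    for x y
  proof -
    let ?f = "\<lambda>k. if k = i then x else if k = j then y else 0"
    have "(\<Sum>r<n. \<Sum>s<n. \<rho> $$ (r, s) * ?f s * cnj (?f r))
       = (\<Sum>r\<in>{i, j}. \<Sum>s\<in>{i, j}. \<rho> $$ (r, s) * ?f s * cnj (?f r))"
      using assms(2,3)
      by (intro sum.mono_neutral_cong_right) (auto intro!: sum.mono_neutral_right sum.neutral)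
    also have "\<dots> = \<rho> $$ (i, i) * x * cnj x + g * y * cnj x + cnj g * x * cnj y + \<rho> $$ (j, j) * y * cnj y"
      using assms(4) g' by (simp add: g_def [symmetric])
    finally show ?thesis
      using psd_quadratic_form [OF \<rho>(1) psd, of ?f] by simp
  qed
  have real_form: "0 \<le> a * p\<^sup>2 - 2 * cmod g * p * q + b * q\<^sup>2" for p q :: real
  proof -
    \<comment> \<open>A phase that rotates \<open>g\<close> onto the nonnegative real axis, which
      leaves a real form in \<open>p\<close> and \<open>q\<close>.\<close>
    define u where "u = (if g = 0 then 1 else cnj g / complex_of_real (cmod g))"
    have u: "g * u = complex_of_real (cmod g)" "u * cnj u = 1"
      by (auto simp: u_def complex_norm_square [symmetric] norm_divide field_simps power2_eq_square)
    have cu: "cnj g * cnj u = complex_of_real (cmod g)"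
      using arg_cong [OF u(1), of cnj] by simp
    let ?x = "complex_of_real p" and ?y = "- (complex_of_real q * u)"
    have "\<rho> $$ (i, i) * ?x * cnj ?x + g * ?y * cnj ?x + cnj g * ?x * cnj ?y + \<rho> $$ (j, j) * ?y * cnj ?y
      = \<rho> $$ (i, i) * ?x * ?x - (g * u) * ?x * complex_of_real q - (cnj g * cnj u) * ?x * complex_of_real q
        + \<rho> $$ (j, j) * (u * cnj u) * complex_of_real q * complex_of_real q"
      by (simp add: algebra_simps)
    also have "\<dots> = complex_of_real (a * p\<^sup>2 - 2 * cmod g * p * q + b * q\<^sup>2)"
      unfolding u cu using diag [OF assms(2)] diag [OF assms(3)]
      by (simp add: a_def b_def power2_eq_square algebra_simps complex_eq_iff)
    finally show ?thesis
      using form [of ?x ?y] by simp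
  qed
  have a0: "0 \<le> a" using real_form [of 1 0] by simp
  have "(cmod g)\<^sup>2 \<le> a * b"
  proof (cases "a = 0")
    case True
    show ?thesis
    proof (rule ccontr)
      assume "\<not> ?thesis"
      then have "cmod g > 0" using True by auto
      \<comment> \<open>With \<open>a = 0\<close> and \<open>q = 1\<close> the form is affine in
        \<open>p\<close>, and this \<open>p\<close> gives it the value \<open>-1\<close>.\<close>
      then show False
        using real_form [of "(b + 1) / (2 * cmod g)" 1] True by simp
    qed
  next
    case False
    have "0 \<le> a * (a * b - (cmod g)\<^sup>2)"
      using real_form [of "cmod g" a] by (simp add: power2_eq_square algebra_simps)
    then show ?thesis using False a0 by (simp add: zero_le_mult_iff)
  qed
  then have "cmod g \<le> sqrt (a * b)"
    by (rule real_le_rsqrt)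
  then show "cmod (\<rho> $$ (i, j)) \<le> sqrt (Re (\<rho> $$ (i, i))) * sqrt (Re (\<rho> $$ (j, j)))"
    by (simp add: g_def a_def b_def real_sqrt_mult)
qed

text \<open>Passing to the pure state keeps the diagonal, hence the expectation of
  \<open>J_X\<^sup>2 + J_Y\<^sup>2\<close>, and makes the neighbouring off-diagonal entries as large
  as positivity permits, so the subtracted square can only grow.\<close>

lemma density_sqrt_diagonal:
  assumes "\<rho> \<in> density_matrices (Suc N)"
  defines "v \<equiv> \<lambda>k. sqrt (Re (\<rho> $$ (k, k)))"
  shows "(\<Sum>k\<le>N. (v k)\<^sup>2) = 1" "\<And>k. k \<le> N \<Longrightarrow> 0 \<le> v k" "pure_variance N v \<le> variance_sum N \<rho>"
proof -
  have \<rho>: "\<rho> \<in> carrier_mat (Suc N) (Suc N)" "mat_adjoint \<rho> = \<rho>"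
    and psd: "\<forall>v\<in>carrier_vec (Suc N). 0 \<le> (\<rho> *\<^sub>v v) \<bullet>c v" and tr: "mat_trace \<rho> = 1"
    using assms(1) by (auto simp: density_matrices_def)
  have nonneg: "0 \<le> Re (\<rho> $$ (k, k))" if "k \<le> N" for k
  proof -
    have "(\<Sum>r<Suc N. \<Sum>s<Suc N. \<rho> $$ (r, s) * (if s = k then 1 else 0) * cnj (if r = k then 1 else 0))
       = (\<Sum>r\<in>{k}. \<Sum>s\<in>{k}. \<rho> $$ (r, s) * (if s = k then 1 else 0) * cnj (if r = k then 1 else 0))"
      using that by (intro sum.mono_neutral_cong_right) (auto intro!: sum.mono_neutral_right sum.neutral)
    then show ?thesis
      using psd_quadratic_form [OF \<rho>(1) psd, of "\<lambda>s. if s = k then 1 else 0"] by simp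
  qed
  then show v0: "\<And>k. k \<le> N \<Longrightarrow> 0 \<le> v k" by (simp add: v_def)
  have v2: "(v k)\<^sup>2 = Re (\<rho> $$ (k, k))" if "k \<le> N" for k
    using nonneg [OF that] by (simp add: v_def)
  have "Re (mat_trace \<rho>) = (\<Sum>k\<le>N. Re (\<rho> $$ (k, k)))"
    using \<rho>(1) by (simp add: mat_trace_def lessThan_Suc_atMost del: sum.lessThan_Suc)
  then show "(\<Sum>k\<le>N. (v k)\<^sup>2) = 1"
    using tr v2 by simp
  have "cmod (\<Sum>k<N. complex_of_real (ladder N k) * \<rho> $$ (Suc k, k))
     \<le> (\<Sum>k<N. cmod (complex_of_real (ladder N k) * \<rho> $$ (Suc k, k)))"
    by (rule norm_sum)
  also have "\<dots> \<le> (\<Sum>k<N. ladder N k * v k * v (Suc k))"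
  proof (rule sum_mono)
    fix k assume k: "k \<in> {..<N}"
    have "cmod (\<rho> $$ (Suc k, k)) \<le> v (Suc k) * v k"
      unfolding v_def using k by (intro density_offdiagonal_bound [OF assms(1)]) auto
    then show "cmod (complex_of_real (ladder N k) * \<rho> $$ (Suc k, k)) \<le> ladder N k * v k * v (Suc k)"
      using ladder_nonneg [of k N] k by (simp add: norm_mult mult_left_mono mult.assoc mult.commute [of "v k"])
  qed
  finally have "(cmod (\<Sum>k<N. complex_of_real (ladder N k) * \<rho> $$ (Suc k, k)))\<^sup>2
     \<le> (\<Sum>k<N. ladder N k * v k * v (Suc k))\<^sup>2"
    by (rule power_mono) simp
  then show "pure_variance N v \<le> variance_sum N \<rho>"
    unfolding pure_variance_def variance_sum_eq [OF \<rho>] using v2 by simp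
qed

lemma pure_state_density:
  assumes "(\<Sum>k\<le>N. (v k)\<^sup>2) = (1 :: real)"
  defines "\<rho> \<equiv> mat (Suc N) (Suc N) (\<lambda>(i, j). complex_of_real (v i * v j))"
  shows "\<rho> \<in> density_matrices (Suc N)" "variance_sum N \<rho> = pure_variance N v"
proof -
  have carrier: "\<rho> \<in> carrier_mat (Suc N) (Suc N)" by (simp add: \<rho>_def)
  have adj: "mat_adjoint \<rho> = \<rho>"
    by (rule eq_matI) (auto simp: \<rho>_def mat_adjoint_def mat_of_rows_def)
  have psd: "0 \<le> (\<rho> *\<^sub>v w) \<bullet>c w" if "w \<in> carrier_vec (Suc N)" for w
  proof -
    define z where "z = (\<Sum>j<Suc N. complex_of_real (v j) * w $ j)"
    have "(\<rho> *\<^sub>v w) \<bullet>c w = (\<Sum>i<Suc N. (\<Sum>j<Suc N. complex_of_real (v i * v j) * w $ j) * cnj (w $ i))"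
      using that by (auto simp: \<rho>_def scalar_prod_def lessThan_atLeast0 intro!: sum.cong)
    also have "\<dots> = (\<Sum>i<Suc N. z * (complex_of_real (v i) * cnj (w $ i)))"
      unfolding z_def sum_distrib_right sum_distrib_left
      by (intro sum.cong refl) (simp add: mult_ac)
    also have "\<dots> = z * cnj z"
      by (simp only: z_def cnj_sum complex_cnj_mult complex_cnj_complex_of_real sum_distrib_left)
    finally show ?thesis
      by (simp add: less_eq_complex_def complex_mult_cnj)
  qed
  have tr: "mat_trace \<rho> = 1"
  proof -
    have "mat_trace \<rho> = complex_of_real (\<Sum>k\<le>N. (v k)\<^sup>2)"
      by (simp add: mat_trace_def \<rho>_def lessThan_Suc_atMost power2_eq_square del: sum.lessThan_Suc)
    then show ?thesis using assms by simp
  qed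
  show "\<rho> \<in> density_matrices (Suc N)"
    using carrier adj psd tr by (simp add: density_matrices_def)
  have S: "(\<Sum>k<N. complex_of_real (ladder N k) * \<rho> $$ (Suc k, k))
     = complex_of_real (\<Sum>k<N. ladder N k * v k * v (Suc k))"
    by (simp add: \<rho>_def mult_ac)
  show "variance_sum N \<rho> = pure_variance N v"
    unfolding variance_sum_eq [OF carrier adj] pure_variance_def S norm_of_real power2_abs
    by (simp add: \<rho>_def power2_eq_square)
qed

section \<open>Existence of a minimising state\<close>

definition unit_vectors :: "nat \<Rightarrow> (nat \<Rightarrow> real) set" where
  "unit_vectors N = {v. (\<forall>k. 0 \<le> v k) \<and> (\<forall>k>N. v k = 0) \<and> (\<Sum>k\<le>N. (v k)\<^sup>2) = 1}"

text \<open>Fixing the entries beyond \<open>N\<close> to 0 makes the set a closed subset of a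
  product of compact sets \<open>{0..1}\<close> and \<open>{0}\<close>, so Tychonoff's theorem
  applies.\<close>

lemma unit_vectors_compact: "compact (unit_vectors N)"
proof -
  define K :: "(nat \<Rightarrow> real) set" where "K = PiE UNIV (\<lambda>k. if k \<le> N then {0..1} else {0})"
  have "compactin (product_topology (\<lambda>_. euclidean) UNIV) K"
    unfolding K_def by (subst compactin_PiE) auto
  then have K: "compact K"
    by (simp add: euclidean_product_topology)
  have "closed {v :: nat \<Rightarrow> real. (\<Sum>k\<le>N. (v k)\<^sup>2) = 1}"
    by (intro closed_Collect_eq continuous_on_sum continuous_on_power continuous_on_const
        continuous_on_product_coordinates)
  moreover have "unit_vectors N = K \<inter> {v. (\<Sum>k\<le>N. (v k)\<^sup>2) = 1}"
  proof -
    have "v k \<le> 1" if "(\<Sum>k\<le>N. (v k)\<^sup>2) = 1" "k \<le> N" for v :: "nat \<Rightarrow> real" and k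
    proof -
      have "(v k)\<^sup>2 \<le> (\<Sum>k\<le>N. (v k)\<^sup>2)"
        using that by (intro member_le_sum) auto
      then show ?thesis using that power2_le_imp_le [of "v k" 1] by simp
    qed
    moreover have "v \<in> K \<longleftrightarrow> (\<forall>k\<le>N. 0 \<le> v k \<and> v k \<le> 1) \<and> (\<forall>k>N. v k = 0)" for v
      by (force simp: K_def PiE_iff not_le)
    ultimately show ?thesis
      unfolding unit_vectors_def set_eq_iff Int_iff mem_Collect_eq
      by (metis linorder_not_less order.refl)
  qed
  ultimately show ?thesis
    using K by (simp add: compact_Int_closed)
qed

lemma pure_variance_attains_min:
  obtains v where "v \<in> unit_vectors N" "\<And>w. w \<in> unit_vectors N \<Longrightarrow> pure_variance N v \<le> pure_variance N w"
proof -
  have "(\<lambda>k. if k = 0 then 1 else 0) \<in> unit_vectors N"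
    by (simp add: unit_vectors_def if_distrib [of "\<lambda>x. x\<^sup>2"] sum.delta cong: if_cong)
  moreover have "continuous_on UNIV (pure_variance N)"
    unfolding pure_variance_def
    by (intro continuous_on_diff continuous_on_sum continuous_on_power continuous_on_mult
        continuous_on_const continuous_on_product_coordinates)
  then have "continuous_on (unit_vectors N) (pure_variance N)"
    by (rule continuous_on_subset) simp
  ultimately show ?thesis
    using continuous_attains_inf [OF unit_vectors_compact, of N "pure_variance N"] that by blast
qed

section \<open>The tridiagonal quadratic form and its double root\<close>

definition lower_coeff :: "nat \<Rightarrow> nat \<Rightarrow> real" where
  "lower_coeff N k = sqrt (real k * (real N + 1 - real k))"

text \<open>The bilinear form of \<open>H(s) - l\<close> for
  \<open>H(s) = J_X\<^sup>2 + J_Y\<^sup>2 - 2 s J_X + s\<^sup>2\<close>.\<close>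

definition bform :: "nat \<Rightarrow> real \<Rightarrow> real \<Rightarrow> (nat \<Rightarrow> real) \<Rightarrow> (nat \<Rightarrow> real) \<Rightarrow> real" where
  "bform N l s w v = (\<Sum>k\<le>N. (diag_coeff N k + s\<^sup>2 - l) * w k * v k)
     - s * (\<Sum>k<N. ladder N k * (w (Suc k) * v k + w k * v (Suc k)))"

text \<open>Row \<open>k\<close> of \<open>H(s) - l\<close> applied to \<open>v\<close>. The
  out-of-range neighbours of rows 0 and \<open>N\<close> drop out because
  \<open>lower_coeff N 0\<close> and \<open>ladder N N\<close> are 0.\<close>

definition residual :: "nat \<Rightarrow> real \<Rightarrow> real \<Rightarrow> (nat \<Rightarrow> real) \<Rightarrow> nat \<Rightarrow> real" where
  "residual N l s v k = (diag_coeff N k + s\<^sup>2 - l) * v k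
     - s * (lower_coeff N k * v (k - 1) + ladder N k * v (Suc k))"

lemma lower_coeff_Suc: "lower_coeff N (Suc k) = ladder N k"
  by (simp add: lower_coeff_def ladder_def algebra_simps)

lemma lower_coeff_0: "lower_coeff N 0 = 0"
  by (simp add: lower_coeff_def)

lemma bform_residual: "bform N l s w v = (\<Sum>k\<le>N. w k * residual N l s v k)"
proof -
  have 1: "(\<Sum>k\<le>N. w k * (lower_coeff N k * v (k - 1))) = (\<Sum>k<N. ladder N k * (w (Suc k) * v k))"
    by (subst sum.atMost_shift) (simp add: lower_coeff_0 lower_coeff_Suc mult_ac)
  have "(\<Sum>k<Suc N. w k * (ladder N k * v (Suc k))) = (\<Sum>k<N. ladder N k * (w k * v (Suc k)))"
    by (simp add: mult_ac) (simp add: ladder_def)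
  then have 2: "(\<Sum>k\<le>N. w k * (ladder N k * v (Suc k))) = (\<Sum>k<N. ladder N k * (w k * v (Suc k)))"
    by (simp only: lessThan_Suc_atMost)
  have "(\<Sum>k\<le>N. w k * residual N l s v k) = (\<Sum>k\<le>N. (diag_coeff N k + s\<^sup>2 - l) * w k * v k
     - s * (w k * (lower_coeff N k * v (k - 1)) + w k * (ladder N k * v (Suc k))))"
    by (intro sum.cong refl) (simp add: residual_def algebra_simps)
  also have "\<dots> = bform N l s w v"
    by (simp only: sum_subtractf sum_distrib_left [symmetric] sum.distrib 1 2 bform_def distrib_left)
  finally show ?thesis ..
qed

lemma bform_add_scaled:
  "bform N l s (\<lambda>k. v k + e * w k) (\<lambda>k. v k + e * w k)
    = bform N l s v v + 2 * e * bform N l s w v + e\<^sup>2 * bform N l s w w"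
  by (simp add: bform_def sum.distrib sum_distrib_left algebra_simps power2_eq_square sum_subtractf)

lemma linear_le_quadratic_imp_zero:
  fixes b c :: real
  assumes "\<And>e. 0 \<le> 2 * e * b + e\<^sup>2 * c"
  shows "b = 0"
proof (rule ccontr)
  assume "b \<noteq> 0"
  have c: "0 \<le> c" using assms [of 1] assms [of "-1"] by simp
  \<comment> \<open>The summand 1 keeps the denominator positive when \<open>c = 0\<close>; the
    expression becomes \<open>- e\<^sup>2 * (c + 2)\<close>.\<close>
  define e where "e = - b / (c + 1)"
  have b: "b = - e * (c + 1)" using c by (simp add: e_def)
  have "0 \<le> - (e\<^sup>2 * (c + 2))"
    using assms [of e] unfolding b by (simp add: algebra_simps power2_eq_square)
  moreover have "0 < e\<^sup>2 * (c + 2)" using c b \<open>b \<noteq> 0\<close> by (auto simp: zero_less_mult_iff)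
  ultimately show False by simp
qed

text \<open>A zero of a nonnegative form is a minimum, so its first variation vanishes. Varying in
  the direction of the residual itself turns this variation into a sum of squares.\<close>

lemma residual_eq_0:
  assumes nonneg: "\<And>w. 0 \<le> bform N l s w w" and "bform N l s v v = 0" "k \<le> N"
  shows "residual N l s v k = 0"
proof -
  let ?r = "residual N l s v"
  have "0 \<le> 2 * e * bform N l s ?r v + e\<^sup>2 * bform N l s ?r ?r" for e
    using nonneg [of "\<lambda>k. v k + e * ?r k"] assms(2) by (simp add: bform_add_scaled)
  then have "bform N l s ?r v = 0"
    by (rule linear_le_quadratic_imp_zero)
  then have "(\<Sum>k\<le>N. ?r k * ?r k) = 0" by (simp only: bform_residual)
  then show ?thesis using assms(3) by (subst (asm) sum_nonneg_eq_0_iff) auto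
qed

text \<open>For fixed \<open>w\<close> the variance is the minimum over \<open>s\<close> of the quadratic form, by completing the
  square in \<open>s\<close>.\<close>

lemma bform_nonneg:
  assumes min: "\<And>w. w \<in> unit_vectors N \<Longrightarrow> c \<le> pure_variance N w" and "l \<le> c"
  shows "0 \<le> bform N l s w w"
proof -
  define n where "n = (\<Sum>k\<le>N. (w k)\<^sup>2)"
  have n0: "0 \<le> n" unfolding n_def by (intro sum_nonneg) auto
  show ?thesis
  proof (cases "n = 0")
    case True
    then have "w k = 0" if "k \<le> N" for k
      using that unfolding n_def by (subst (asm) sum_nonneg_eq_0_iff) auto
    then show ?thesis by (simp add: bform_def)
  next
    case False
    then have n: "0 < n" using n0 by simp
    \<comment> \<open>Only nonnegative unit vectors are covered by the assumption, so
      \<open>w\<close> is replaced by its normalised absolute values. As the ladder coefficients are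
      nonnegative, this can only increase the size of the coupling term, and \<open>s\<close> gets
      replaced by \<open>\<bar>s\<bar>\<close>.\<close>
    define u where "u = (\<lambda>k. if k \<le> N then \<bar>w k\<bar> / sqrt n else 0)"
    have u2: "(u k)\<^sup>2 = (w k)\<^sup>2 / n" if "k \<le> N" for k
      using that n by (simp add: u_def power_divide)
    have usum: "(\<Sum>k\<le>N. (u k)\<^sup>2) = 1"
      using n by (simp add: u2 sum_divide_distrib [symmetric] n_def [symmetric])
    then have "u \<in> unit_vectors N"
      using n by (simp add: unit_vectors_def u_def)
    then have c: "c \<le> pure_variance N u" by (rule min)
    define D X Y where "D = (\<Sum>k\<le>N. diag_coeff N k * (u k)\<^sup>2)"
      and "X = (\<Sum>k<N. ladder N k * w k * w (Suc k))" and "Y = (\<Sum>k<N. ladder N k * u k * u (Suc k))"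
    have "\<bar>X\<bar> \<le> (\<Sum>k<N. \<bar>ladder N k * w k * w (Suc k)\<bar>)"
      unfolding X_def by (rule sum_abs)
    also have "\<dots> = n * Y"
      unfolding Y_def sum_distrib_left
      using n by (intro sum.cong) (auto simp: u_def abs_mult ladder_nonneg)
    finally have XY: "\<bar>X\<bar> \<le> n * Y" .
    have "s * X \<le> \<bar>s\<bar> * (n * Y)"
      using XY by (metis abs_ge_self abs_ge_zero abs_mult mult_left_mono order_trans)
    moreover have "bform N l s w w = n * D + (s\<^sup>2 - l) * n - 2 * s * X"
    proof -
      have "n * D = (\<Sum>k\<le>N. diag_coeff N k * (w k)\<^sup>2)"
        using n by (simp add: D_def sum_distrib_left u2)
      moreover have "(\<Sum>k\<le>N. (diag_coeff N k + s\<^sup>2 - l) * w k * w k)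
         = (\<Sum>k\<le>N. diag_coeff N k * (w k)\<^sup>2) + (s\<^sup>2 - l) * n"
        unfolding n_def sum_distrib_left sum.distrib [symmetric]
        by (intro sum.cong refl) (simp add: algebra_simps power2_eq_square)
      moreover have "(\<Sum>k<N. ladder N k * (w (Suc k) * w k + w k * w (Suc k))) = 2 * X"
        unfolding X_def sum_distrib_left by (intro sum.cong refl) (simp add: algebra_simps)
      ultimately show ?thesis by (simp add: bform_def)
    qed
    ultimately have "n * (D + s\<^sup>2 - l - 2 * \<bar>s\<bar> * Y) \<le> bform N l s w w"
      by (simp add: algebra_simps)
    moreover have "0 \<le> D + s\<^sup>2 - l - 2 * \<bar>s\<bar> * Y"
    proof -
      have "0 \<le> (\<bar>s\<bar> - Y)\<^sup>2" by simp
      then show ?thesis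
        using c \<open>l \<le> c\<close> by (simp add: pure_variance_def D_def Y_def power2_diff)
    qed
    ultimately show ?thesis
      using n by (meson mult_nonneg_nonneg order_trans less_imp_le)
  qed
qed

text \<open>\<open>t\<close> is the expectation of \<open>J_X\<close> in the state \<open>v\<close>,
  the value of \<open>s\<close> at which the completed square is 0.\<close>

lemma bform_minimizer:
  assumes "(\<Sum>k\<le>N. (v k)\<^sup>2) = 1"
  defines "t \<equiv> \<Sum>k<N. ladder N k * v k * v (Suc k)"
  shows "bform N (pure_variance N v) t v v = 0"
proof -
  let ?c = "pure_variance N v"
  have "(\<Sum>k\<le>N. (diag_coeff N k + t\<^sup>2 - ?c) * v k * v k)
     = (\<Sum>k\<le>N. diag_coeff N k * (v k)\<^sup>2) + (t\<^sup>2 - ?c) * (\<Sum>k\<le>N. (v k)\<^sup>2)"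
    unfolding sum_distrib_left sum.distrib [symmetric]
    by (intro sum.cong refl) (simp add: algebra_simps power2_eq_square)
  moreover have "(\<Sum>k<N. ladder N k * (v (Suc k) * v k + v k * v (Suc k))) = 2 * t"
    unfolding t_def sum_distrib_left by (intro sum.cong refl) (simp add: algebra_simps)
  ultimately show ?thesis
    using assms(1) by (simp add: bform_def pure_variance_def t_def [symmetric] power2_eq_square)
qed

section \<open>Continuants and the determinant on the symmetric sector\<close>

text \<open>Determinant of the upper left block of size \<open>k\<close> of \<open>H(s) - l\<close>,
  by the continuant recurrence. Couplings enter only squared, so no square roots occur. At
  \<open>k = 0\<close> the junk index \<open>k - 1\<close> carries the factor 0.\<close>

fun leading_minor :: "nat \<Rightarrow> real \<Rightarrow> nat \<Rightarrow> real poly" where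
  "leading_minor N l 0 = 1"
| "leading_minor N l (Suc k) = [:diag_coeff N k - l, 0, 1:] * leading_minor N l k
     - [:0, 0, real k * (real N + 1 - real k):] * leading_minor N l (k - 1)"

text \<open>Folding along \<open>k \<mapsto> N - k\<close>: for even \<open>N\<close> the middle vector is coupled to both neighbours, which
  doubles the last term; for odd \<open>N\<close> the coupling of the two middle vectors, \<open>ladder N m = m + 1\<close>,
  becomes a diagonal entry.\<close>

definition secular_poly :: "nat \<Rightarrow> real \<Rightarrow> real poly" where
  "secular_poly N l = (let m = N div 2 in
     if even N
     then [:diag_coeff N m - l, 0, 1:] * leading_minor N l m
       - [:0, 0, 2 * (real m * (real N + 1 - real m)):] * leading_minor N l (m - 1)
     else [:diag_coeff N m - l, - (real m + 1), 1:] * leading_minor N l m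
       - [:0, 0, real m * (real N + 1 - real m):] * leading_minor N l (m - 1))"

text \<open>With the power \<open>s ^ k\<close> this is, up to sign, the product of the first
  \<open>k\<close> couplings: the denominator of entry \<open>k\<close> when the recurrence is
  solved forward.\<close>

definition ladder_prod :: "nat \<Rightarrow> nat \<Rightarrow> real" where
  "ladder_prod N k = (\<Prod>i<k. ladder N i)"

lemma lower_coeff_sq: "k \<le> N \<Longrightarrow> lower_coeff N k * lower_coeff N k = real k * (real N + 1 - real k)"
  by (simp add: lower_coeff_def)

lemma ladder_prod_Suc: "ladder_prod N (Suc k) = ladder_prod N k * ladder N k"
  by (simp add: ladder_prod_def)

text \<open>At \<open>k = 0\<close> the index \<open>k - 1\<close> is junk, but it only occurs with the factor \<open>lower_coeff N 0 = 0\<close>.\<close>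

lemma minor_step:
  assumes "k \<le> N" "s ^ k * ladder_prod N k * w k = poly (leading_minor N l k) s * w 0"
    "k > 0 \<Longrightarrow> s ^ (k - 1) * ladder_prod N (k - 1) * w (k - 1) = poly (leading_minor N l (k - 1)) s * w 0"
  shows "s ^ k * ladder_prod N k * ((diag_coeff N k + s\<^sup>2 - l) * w k - s * (lower_coeff N k * w (k - 1)))
     = poly (leading_minor N l (Suc k)) s * w 0"
    and "s ^ k * ladder_prod N k * (s * (lower_coeff N k * w (k - 1)))
     = s\<^sup>2 * (real k * (real N + 1 - real k)) * poly (leading_minor N l (k - 1)) s * w 0"
proof -
  show 2: "s ^ k * ladder_prod N k * (s * (lower_coeff N k * w (k - 1)))
     = s\<^sup>2 * (real k * (real N + 1 - real k)) * poly (leading_minor N l (k - 1)) s * w 0"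
  proof (cases k)
    case 0
    then show ?thesis by (simp add: lower_coeff_0)
  next
    case (Suc j)
    have "s ^ k * ladder_prod N k * (s * (lower_coeff N k * w (k - 1)))
      = s\<^sup>2 * (lower_coeff N k * lower_coeff N k) * (s ^ (k - 1) * ladder_prod N (k - 1) * w (k - 1))"
      by (simp add: Suc ladder_prod_Suc lower_coeff_Suc power2_eq_square)
    also have "\<dots> = s\<^sup>2 * (real k * (real N + 1 - real k)) * (poly (leading_minor N l (k - 1)) s * w 0)"
      using assms(3) lower_coeff_sq [OF assms(1)] Suc by simp
    finally show ?thesis by simp
  qed
  have "s ^ k * ladder_prod N k * ((diag_coeff N k + s\<^sup>2 - l) * w k)
     = (diag_coeff N k + s\<^sup>2 - l) * (s ^ k * ladder_prod N k * w k)" by simp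
  then show "s ^ k * ladder_prod N k * ((diag_coeff N k + s\<^sup>2 - l) * w k - s * (lower_coeff N k * w (k - 1)))
     = poly (leading_minor N l (Suc k)) s * w 0"
    unfolding right_diff_distrib 2 assms(2) by (simp add: algebra_simps power2_eq_square)
qed

text \<open>Row \<open>j\<close> determines entry \<open>j + 1\<close> from the two before it, so
  \<open>w 0\<close> fixes the rest; after clearing the couplings this is the recurrence of the
  minors.\<close>

lemma leading_minor_recurrence:
  assumes "\<And>k. k < m \<Longrightarrow> residual N l s w k = 0" "m \<le> N" "k \<le> m"
  shows "s ^ k * ladder_prod N k * w k = poly (leading_minor N l k) s * w 0"
  using assms(3)
proof (induction k rule: less_induct)
  case (less k)
  show ?case
  proof (cases k)
    case 0
    then show ?thesis by (simp add: ladder_prod_def)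
  next
    case (Suc j)
    have j: "j < m" using Suc less.prems by simp
    have "s ^ k * ladder_prod N k * w k = s ^ j * ladder_prod N j * (s * (ladder N j * w (Suc j)))"
      by (simp add: Suc ladder_prod_Suc)
    also have "s * (ladder N j * w (Suc j))
        = (diag_coeff N j + s\<^sup>2 - l) * w j - s * (lower_coeff N j * w (j - 1))"
      using assms(1) [OF j] by (simp add: residual_def algebra_simps)
    also have "s ^ j * ladder_prod N j * \<dots> = poly (leading_minor N l (Suc j)) s * w 0"
      using j assms(2) Suc less.prems by (intro minor_step less.IH) auto
    finally show ?thesis by (simp only: Suc)
  qed
qed

text \<open>By symmetry \<open>w (Suc m)\<close> equals \<open>w (m - 1)\<close> for even
  \<open>N\<close> and \<open>w m\<close> for odd \<open>N\<close>, so the middle row involves no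
  entry beyond the middle and the recurrence closes up into the folded determinant.\<close>

lemma middle_residual:
  assumes res: "\<And>k. k < N div 2 \<Longrightarrow> residual N l s w k = 0" and sym: "\<And>k. k \<le> N \<Longrightarrow> w (N - k) = w k"
    and N: "0 < N"
  defines "m \<equiv> N div 2"
  shows "s ^ m * ladder_prod N m * residual N l s w m = poly (secular_poly N l) s * w 0"
proof -
  have mN: "m \<le> N" by (simp add: m_def)
  have rec: "s ^ k * ladder_prod N k * w k = poly (leading_minor N l k) s * w 0" if "k \<le> m" for k
    using leading_minor_recurrence [of m N l s w k] res mN that by (simp add: m_def)
  note step = minor_step [OF mN rec rec, OF order.refl diff_le_self]
  let ?L = "s ^ m * ladder_prod N m"
  have res_eq: "residual N l s w m = ((diag_coeff N m + s\<^sup>2 - l) * w m - s * (lower_coeff N m * w (m - 1)))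
      - s * (ladder N m * w (Suc m))"
    by (simp add: residual_def algebra_simps)
  show ?thesis
  proof (cases "even N")
    case True
    then have Nm: "N = 2 * m" by (simp add: m_def)
    have "w (Suc m) = w (N - Suc m)" using sym [of "Suc m"] N Nm by simp
    moreover have "N - Suc m = m - 1" using Nm by simp
    moreover have "ladder N m = lower_coeff N m" by (simp add: ladder_def lower_coeff_def Nm algebra_simps)
    ultimately have "?L * residual N l s w m = poly (leading_minor N l (Suc m)) s * w 0
       - s\<^sup>2 * (real m * (real N + 1 - real m)) * poly (leading_minor N l (m - 1)) s * w 0"
      unfolding res_eq right_diff_distrib [of ?L "_ - _"] step(1) by (simp only: step(2))
    then show ?thesis using True
      by (simp add: secular_poly_def m_def [symmetric] Let_def algebra_simps power2_eq_square)
  next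
    case False
    then have Nm: "N = 2 * m + 1" by (simp add: m_def)
    have "w (Suc m) = w (N - Suc m)" using sym [of "Suc m"] N Nm by simp
    moreover have "N - Suc m = m" using Nm by simp
    moreover have "ladder N m = real m + 1"
      by (simp add: ladder_def Nm)
    ultimately have "?L * residual N l s w m = poly (leading_minor N l (Suc m)) s * w 0
       - s * (real m + 1) * (?L * w m)"
      unfolding res_eq right_diff_distrib [of ?L "_ - _"] step(1) by simp
    then show ?thesis using False
      unfolding rec [OF order.refl]
      by (simp add: secular_poly_def m_def [symmetric] Let_def algebra_simps power2_eq_square)
  qed
qed

section \<open>Reflection symmetry and the double root\<close>

lemma lower_coeff_reflect: "k \<le> N \<Longrightarrow> lower_coeff N (N - k) = ladder N k"
  by (simp add: lower_coeff_def ladder_def of_nat_diff algebra_simps)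

lemma ladder_reflect: "k \<le> N \<Longrightarrow> ladder N (N - k) = lower_coeff N k"
  by (simp add: lower_coeff_def ladder_def of_nat_diff algebra_simps)

lemma diag_coeff_reflect: "k \<le> N \<Longrightarrow> diag_coeff N (N - k) = diag_coeff N k"
  by (simp add: diag_coeff_def of_nat_diff algebra_simps)

lemma residual_reflect:
  assumes "k \<le> N"
  shows "residual N l s (\<lambda>i. v (N - i)) k = residual N l s v (N - k)"
proof -
  have "lower_coeff N k * v (N - (k - 1)) = lower_coeff N k * v (Suc (N - k))"
    using assms by (cases k) (auto simp: lower_coeff_0 Suc_diff_Suc)
  then show ?thesis
    using assms
    by (auto simp: residual_def diag_coeff_reflect lower_coeff_reflect ladder_reflect algebra_simps)
qed

lemma residual_cong:
  assumes "k \<le> N" "\<And>i. i \<le> N \<Longrightarrow> v i = w i"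
  shows "residual N l s v k = residual N l s w k"
proof -
  have "ladder N k * v (Suc k) = ladder N k * w (Suc k)"
    using assms by (cases "k = N") (auto simp: ladder_def)
  then show ?thesis using assms by (simp add: residual_def)
qed

lemma ladder_prod_pos: "k \<le> N \<Longrightarrow> 0 < ladder_prod N k"
  unfolding ladder_prod_def by (intro prod_pos) (simp add: ladder_def)

text \<open>The form is evaluated at the reflected solution of the recurrence. All rows except the
  middle ones vanish, so its value is \<open>w m\<close> times the middle residual; these two
  factors are the minor and the secular polynomial up to the same scaling.\<close>

lemma minor_times_secular_nonneg:
  assumes min: "\<And>w. w \<in> unit_vectors N \<Longrightarrow> c \<le> pure_variance N w"
    and "l \<le> c" "s \<noteq> 0" "0 < N"
  shows "0 \<le> poly (leading_minor N l (N div 2)) s * poly (secular_poly N l) s"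
proof -
  define m where "m = N div 2"
  define y where "y k = poly (leading_minor N l k) s / (s ^ k * ladder_prod N k)" for k
  define w where "w k = y (min k (N - k))" for k
  have mN: "m \<le> N" by (simp add: m_def)
  have scale: "s ^ k * ladder_prod N k \<noteq> 0" if "k \<le> N" for k
    using ladder_prod_pos [OF that] \<open>s \<noteq> 0\<close> by simp
  have w0: "w 0 = 1" by (simp add: w_def y_def ladder_prod_def)
  have sym: "w (N - k) = w k" if "k \<le> N" for k
    using that by (simp add: w_def min.commute)
  have wk: "s ^ k * ladder_prod N k * w k = poly (leading_minor N l k) s * w 0" if "k \<le> m" for k
  proof -
    have "min k (N - k) = k" using that by (simp add: m_def)
    then have "w k = y k" by (simp add: w_def)
    moreover have "s ^ k * ladder_prod N k \<noteq> 0" using that mN by (intro scale) simp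
    moreover have "a * (b / a) = b" if "a \<noteq> 0" for a b :: real using that by simp
    ultimately show ?thesis by (simp only: y_def w0 mult_1_right)
  qed
  have res: "residual N l s w k = 0" if "k < m" for k
  proof -
    have kN: "k \<le> N" using that mN by simp
    have "s ^ k * ladder_prod N k * (s * (ladder N k * w (Suc k))) = poly (leading_minor N l (Suc k)) s * w 0"
      using wk [of "Suc k"] that by (simp add: ladder_prod_Suc mult_ac)
    moreover have "s ^ k * ladder_prod N k *
        ((diag_coeff N k + s\<^sup>2 - l) * w k - s * (lower_coeff N k * w (k - 1)))
      = poly (leading_minor N l (Suc k)) s * w 0"
      by (rule minor_step(1)) (use that kN wk in auto)
    ultimately have "s ^ k * ladder_prod N k * residual N l s w k = 0"
      by (simp add: residual_def algebra_simps)
    then show ?thesis using scale [OF kN] \<open>s \<noteq> 0\<close> by simp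
  qed
  have res_sym: "residual N l s w (N - k) = residual N l s w k" if "k \<le> N" for k
    using residual_reflect [OF that, of l s w] residual_cong [OF that, of "\<lambda>i. w (N - i)" w l s] sym
    by simp
  \<comment> \<open>\<open>q\<close> counts the middle positions: one for even \<open>N\<close>, two
    for odd \<open>N\<close>.\<close>
  have eq: "\<exists>q>0. bform N l s w w = q * (w m * residual N l s w m)"
  proof (cases "even N")
    case True
    then have Nm: "N = 2 * m" by (simp add: m_def)
    have "residual N l s w k = 0" if "k \<le> N" "k \<noteq> m" for k
      using res [of k] res [of "N - k"] res_sym [of k] that Nm by (cases "k < m") auto
    then have "bform N l s w w = (\<Sum>k\<le>N. if k = m then w m * residual N l s w m else 0)"
      unfolding bform_residual by (intro sum.cong) auto
    also have "\<dots> = w m * residual N l s w m" using mN by simp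
    finally show ?thesis by (intro exI [of _ 1]) simp
  next
    case False
    then have Nm: "N = 2 * m + 1" by (simp add: m_def)
    have "residual N l s w k = 0" if "k \<le> N" "k \<noteq> m" "k \<noteq> Suc m" for k
      using res [of k] res [of "N - k"] res_sym [of k] that Nm by (cases "k < m") auto
    moreover have "N - m = Suc m" using Nm by simp
    then have "w (Suc m) = w m" "residual N l s w (Suc m) = residual N l s w m"
      using sym [OF mN] res_sym [OF mN] by simp_all
    ultimately have "bform N l s w w = (\<Sum>k\<le>N. (if k = m then w m * residual N l s w m else 0)
        + (if k = Suc m then w m * residual N l s w m else 0))"
      unfolding bform_residual by (intro sum.cong) auto
    also have "\<dots> = 2 * (w m * residual N l s w m)"
      using mN Nm by (simp add: sum.distrib)
    finally show ?thesis by (intro exI [of _ 2]) simp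
  qed
  then have "0 \<le> w m * residual N l s w m"
    using bform_nonneg [OF min \<open>l \<le> c\<close>, of s w] by (auto simp: zero_le_mult_iff)
  then have "0 \<le> (s ^ m * ladder_prod N m)\<^sup>2 * (w m * residual N l s w m)" by simp
  also have "\<dots> = (s ^ m * ladder_prod N m * w m) * (s ^ m * ladder_prod N m * residual N l s w m)"
    by (simp add: power2_eq_square)
  also have "s ^ m * ladder_prod N m * residual N l s w m = poly (secular_poly N l) s * w 0"
    unfolding m_def using res sym \<open>0 < N\<close> by (intro middle_residual) (auto simp: m_def)
  finally show ?thesis
    using wk [of m] by (simp add: w0 m_def)
qed

text \<open>Two neighbouring zeros would propagate down the recurrence to
  \<open>leading_minor N l 0 = 1\<close>.\<close>

lemma consecutive_minors_nonzero:
  assumes "s \<noteq> 0" "k < N" "poly (leading_minor N l k) s = 0" "poly (leading_minor N l (Suc k)) s = 0"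
  shows False
  using assms(2-)
proof (induction k)
  case 0
  then show ?case by simp
next
  case (Suc k)
  have "s * s * (real (Suc k) * (real N + 1 - real (Suc k))) * poly (leading_minor N l k) s = 0"
    using Suc.prems(2,3) by (subst (asm) leading_minor.simps(2)) (simp del: leading_minor.simps)
  then have "poly (leading_minor N l k) s = 0"
    using \<open>s \<noteq> 0\<close> Suc.prems(1) by simp
  then show ?case using Suc by simp
qed

text \<open>If the minor vanished, the secular polynomial would reduce to its last term, so the
  preceding minor would vanish as well.\<close>

lemma minor_nonzero_at_secular_root:
  assumes "s \<noteq> 0" "poly (secular_poly N l) s = 0"
  shows "poly (leading_minor N l (N div 2)) s \<noteq> 0"
proof
  define m where "m = N div 2"
  assume "poly (leading_minor N l (N div 2)) s = 0"
  then have 0: "poly (leading_minor N l m) s = 0" by (simp add: m_def)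
  show False
  proof (cases m)
    case 0
    then show ?thesis using \<open>poly (leading_minor N l m) s = 0\<close> by simp
  next
    case (Suc j)
    have jN: "real (Suc j) < real N + 1" using Suc by (simp add: m_def)
    have "poly (leading_minor N l j) s = 0"
      using assms(2) 0 \<open>s \<noteq> 0\<close> jN unfolding secular_poly_def Let_def m_def [symmetric] unfolding Suc
      by (auto split: if_splits)
    then show False
      using \<open>s \<noteq> 0\<close> 0 Suc by (intro consecutive_minors_nonzero [of s j N l]) (simp_all add: m_def)
  qed
qed

lemma diag_coeff_ge: "k \<le> N \<Longrightarrow> real N / 2 \<le> diag_coeff N k"
proof -
  assume "k \<le> N"
  then have "0 \<le> real k * (real N - real k)" by simp
  then show ?thesis by (simp add: diag_coeff_def field_simps)
qed

text \<open>Minor times secular polynomial is nonnegative near \<open>t\<close> and zero at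
  \<open>t\<close>, so its derivative vanishes there. The minor is nonzero at \<open>t\<close>,
  which leaves the derivative of the secular polynomial.\<close>

lemma pure_variance_min_double_root:
  assumes v: "v \<in> unit_vectors N"
    and min: "\<And>w. w \<in> unit_vectors N \<Longrightarrow> pure_variance N v \<le> pure_variance N w"
    and small: "pure_variance N v < real N / 2" and "0 < N"
  obtains t where "t \<noteq> 0" "poly (secular_poly N (pure_variance N v)) t = 0"
    "poly (pderiv (secular_poly N (pure_variance N v))) t = 0"
proof -
  define c where "c = pure_variance N v"
  define t where "t = (\<Sum>k<N. ladder N k * v k * v (Suc k))"
  define m where "m = N div 2"
  have mN: "m \<le> N" by (simp add: m_def)
  have v0: "0 \<le> v k" and v1: "(\<Sum>k\<le>N. (v k)\<^sup>2) = 1" for k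
    using v by (auto simp: unit_vectors_def)
  \<comment> \<open>With \<open>t = 0\<close> nothing is subtracted from the diagonal part, which is
    at least \<open>N / 2\<close>.\<close>
  have "t \<noteq> 0"
  proof
    assume "t = 0"
    then have "c = (\<Sum>k\<le>N. diag_coeff N k * (v k)\<^sup>2)"
      by (simp add: c_def pure_variance_def t_def)
    also have "\<dots> \<ge> (\<Sum>k\<le>N. real N / 2 * (v k)\<^sup>2)"
      by (intro sum_mono mult_right_mono diag_coeff_ge) auto
    finally have "real N / 2 * (\<Sum>k\<le>N. (v k)\<^sup>2) \<le> c"
      by (simp only: sum_distrib_left)
    then show False using small v1 by (simp add: c_def)
  qed
  have nonneg: "0 \<le> bform N c t w w" for w
    by (rule bform_nonneg [where c = c]) (use min in \<open>auto simp: c_def\<close>)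
  have "bform N c t v v = 0"
    unfolding c_def t_def by (rule bform_minimizer [OF v1])
  then have resv: "residual N c t v k = 0" if "k \<le> N" for k
    using nonneg that by (intro residual_eq_0) auto
  \<comment> \<open>The reflection of \<open>v\<close> is in the kernel too. Since \<open>v\<close>
    is nonnegative, no cancellation occurs and the symmetrised vector is nonzero; the recurrence
    then forces \<open>x 0 \<noteq> 0\<close>.\<close>
  define x where "x k = v k + v (N - k)" for k
  have sym: "x (N - k) = x k" if "k \<le> N" for k
    using that by (simp add: x_def)
  have resx: "residual N c t x k = 0" if "k \<le> N" for k
  proof -
    have "residual N c t x k = residual N c t v k + residual N c t (\<lambda>i. v (N - i)) k"
      by (simp add: residual_def x_def algebra_simps)
    then show ?thesis using resv that by (simp add: residual_reflect)
  qed
  have "x 0 \<noteq> 0"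
  proof
    assume "x 0 = 0"
    have half: "x k = 0" if "k \<le> m" for k
    proof -
      have "t ^ k * ladder_prod N k * x k = poly (leading_minor N c k) t * x 0"
        using that mN by (intro leading_minor_recurrence [of m] resx) auto
      then show ?thesis
        using \<open>x 0 = 0\<close> \<open>t \<noteq> 0\<close> ladder_prod_pos [of k N] that mN by simp
    qed
    have "x k = 0" if "k \<le> N" for k
      using half [of k] half [of "N - k"] sym [OF that] by (cases "k \<le> m") (auto simp: m_def)
    then have "v k = 0" if "k \<le> N" for k
      using that v0 [of k] v0 [of "N - k"] unfolding x_def by (smt (verit))
    then show False using v1 by simp
  qed
  have "t ^ m * ladder_prod N m * residual N c t x m = poly (secular_poly N c) t * x 0"
    unfolding m_def using \<open>0 < N\<close> sym by (intro middle_residual resx) auto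
  then have root: "poly (secular_poly N c) t = 0"
    using resx [OF mN] \<open>x 0 \<noteq> 0\<close> by simp
  then have minor: "poly (leading_minor N c m) t \<noteq> 0"
    using minor_nonzero_at_secular_root [OF \<open>t \<noteq> 0\<close>] by (simp add: m_def)
  define g where "g = leading_minor N c m * secular_poly N c"
  have "poly (pderiv g) t = 0"
  proof (rule DERIV_local_min [OF poly_DERIV])
    \<comment> \<open>The radius \<open>\<bar>t\<bar>\<close> keeps the point 0 out of the
      neighbourhood, where the sign of the product is not covered.\<close>
    show "0 < \<bar>t\<bar>" using \<open>t \<noteq> 0\<close> by simp
    show "\<forall>y. \<bar>t - y\<bar> < \<bar>t\<bar> \<longrightarrow> poly g t \<le> poly g y"
    proof (intro allI impI)
      fix y assume "\<bar>t - y\<bar> < \<bar>t\<bar>"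
      then have "y \<noteq> 0" by auto
      then have "0 \<le> poly g y"
        using minor_times_secular_nonneg [of N c c y] min \<open>0 < N\<close> by (simp add: g_def m_def c_def)
      then show "poly g t \<le> poly g y" by (simp add: g_def root)
    qed
  qed
  then have "poly (pderiv (secular_poly N c)) t = 0"
    using minor root by (simp add: g_def pderiv_mult)
  then show ?thesis using that \<open>t \<noteq> 0\<close> root by (simp add: c_def)
qed

section \<open>Attainment and criteria for the minimum\<close>

lemma min_variance_sum_eq:
  obtains v where "v \<in> unit_vectors N" "pure_variance N v = min_variance_sum N"
    "\<And>w. w \<in> unit_vectors N \<Longrightarrow> min_variance_sum N \<le> pure_variance N w"
    "\<exists>\<rho>\<in>density_matrices (Suc N). variance_sum N \<rho> = min_variance_sum N \<and>
       (\<forall>\<sigma>\<in>density_matrices (Suc N). variance_sum N \<rho> \<le> variance_sum N \<sigma>)"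
proof -
  obtain v where v: "v \<in> unit_vectors N"
    and min: "\<And>w. w \<in> unit_vectors N \<Longrightarrow> pure_variance N v \<le> pure_variance N w"
    using pure_variance_attains_min [of N] by blast
  have "(\<Sum>k\<le>N. (v k)\<^sup>2) = 1" using v by (simp add: unit_vectors_def)
  note pure = pure_state_density [OF this]
  define \<rho> where "\<rho> = mat (Suc N) (Suc N) (\<lambda>(i, j). complex_of_real (v i * v j))"
  have \<rho>: "\<rho> \<in> density_matrices (Suc N)" "variance_sum N \<rho> = pure_variance N v"
    unfolding \<rho>_def by (rule pure)+
  have le: "variance_sum N \<rho> \<le> variance_sum N \<sigma>" if "\<sigma> \<in> density_matrices (Suc N)" for \<sigma>
  proof -
    define u where "u k = (if k \<le> N then sqrt (Re (\<sigma> $$ (k, k))) else 0)" for k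
    have "pure_variance N u = pure_variance N (\<lambda>k. sqrt (Re (\<sigma> $$ (k, k))))"
      by (simp add: pure_variance_def u_def)
    moreover have "u \<in> unit_vectors N"
      using density_sqrt_diagonal(1,2) [OF that] by (simp add: unit_vectors_def u_def)
    ultimately show ?thesis
      using min [of u] density_sqrt_diagonal(3) [OF that] \<rho>(2) by simp
  qed
  have eq: "min_variance_sum N = variance_sum N \<rho>"
    unfolding min_variance_sum_def by (rule cInf_eq_minimum) (use \<rho>(1) le in auto)
  show ?thesis
  proof (rule that [OF v])
    show "\<exists>\<rho>\<in>density_matrices (Suc N). variance_sum N \<rho> = min_variance_sum N \<and>
       (\<forall>\<sigma>\<in>density_matrices (Suc N). variance_sum N \<rho> \<le> variance_sum N \<sigma>)"
      using \<rho>(1) le eq by auto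
  qed (use \<rho>(2) eq min in auto)
qed

text \<open>Turns an upper bound into a sign check at a single rational point, by contraposition of
  \<open>minor_times_secular_nonneg\<close>.\<close>

lemma min_variance_sum_less:
  assumes "poly (leading_minor N l (N div 2)) s * poly (secular_poly N l) s < 0" "s \<noteq> 0" "0 < N"
  shows "min_variance_sum N < l"
proof (rule ccontr)
  assume l: "\<not> min_variance_sum N < l"
  obtain v where "\<And>w. w \<in> unit_vectors N \<Longrightarrow> min_variance_sum N \<le> pure_variance N w"
    by (rule min_variance_sum_eq [of N]) auto
  then show False
    using minor_times_secular_nonneg [of N "min_variance_sum N" l s] assms l by simp
qed

lemma min_variance_sum_double_root:
  assumes "min_variance_sum N < real N / 2" "0 < N"
  obtains t where "t \<noteq> 0" "poly (secular_poly N (min_variance_sum N)) t = 0"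
    "poly (pderiv (secular_poly N (min_variance_sum N))) t = 0"
proof -
  obtain v where "v \<in> unit_vectors N" "pure_variance N v = min_variance_sum N"
    "\<And>w. w \<in> unit_vectors N \<Longrightarrow> min_variance_sum N \<le> pure_variance N w"
    by (rule min_variance_sum_eq [of N]) auto
  then show ?thesis
    using pure_variance_min_double_root [of v N] assms that by auto
qed

section \<open>Discriminants and enclosures\<close>

lemma leading_minor_numeral:
  "leading_minor N l (numeral n) = [:diag_coeff N (pred_numeral n) - l, 0, 1:] * leading_minor N l (pred_numeral n)
     - [:0, 0, real (pred_numeral n) * (real N + 1 - real (pred_numeral n)):] * leading_minor N l (pred_numeral n - 1)"
  by (simp add: numeral_eq_Suc)

lemma leading_minor_1: "leading_minor N l (Suc 0) = [:diag_coeff N 0 - l, 0, 1:]"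
  by simp

lemma map_poly_poly_pCons:
  "map_poly (\<lambda>p. poly p c) (pCons a F) = pCons (poly a (c :: real)) (map_poly (\<lambda>p. poly p c) F)"
  by (rule poly_eqI) (simp add: coeff_map_poly coeff_pCons split: nat.split)

text \<open>The outer variable is \<open>s\<close> and the inner one the eigenvalue; the order in
  which they are specialised does not matter.\<close>

lemma poly_poly_const:
  "poly (poly F [:t:]) c = poly (map_poly (\<lambda>p. poly p c) F) (t :: real)"
  by (induction F) (simp_all add: map_poly_poly_pCons)

lemma map_poly_poly_add:
  "map_poly (\<lambda>p. poly p c) (F + G) = map_poly (\<lambda>p. poly p (c :: real)) F + map_poly (\<lambda>p. poly p c) G"
  by (rule poly_eqI) (simp add: coeff_map_poly)

lemma map_poly_pderiv:
  "map_poly (\<lambda>p. poly p c) (pderiv F) = pderiv (map_poly (\<lambda>p. poly p (c :: real)) F)"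
  by (induction F) (simp_all add: pderiv_pCons map_poly_poly_pCons map_poly_poly_add)

text \<open>Below, \<open>F\<close> is the secular polynomial, as a polynomial in \<open>s\<close> (in \<open>s\<^sup>2\<close> for even \<open>N\<close>) with
  coefficients in the eigenvalue variable, and \<open>A\<close>, \<open>B\<close> are the cofactors from the Sylvester matrix that
  express its discriminant by \<open>F\<close> and \<open>pderiv F\<close>.\<close>

lemma common_root_elimination:
  fixes F A B :: "real poly poly"
  assumes "A * F + B * pderiv F = [:smult d (p * h):]" "d \<noteq> 0"
    "poly (map_poly (\<lambda>p. poly p c) F) s = 0" "poly (pderiv (map_poly (\<lambda>p. poly p c) F)) s = 0"
  shows "poly p c = 0 \<or> poly h c = 0"
proof -
  have "d * (poly p c * poly h c) = poly (poly (A * F + B * pderiv F) [:s:]) c" unfolding assms(1) by simp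
  also have "\<dots> = 0"
    using assms(3,4) by (simp add: poly_poly_const map_poly_pderiv)
  finally show ?thesis using assms(2) by simp
qed

text \<open>\<open>L\<close> clears the denominators of the secular polynomial, so that the
  certificates have integer coefficients; \<open>h\<close> is the factor of the discriminant that is
  to be excluded separately.\<close>

lemma discriminant_vanishes:
  fixes F A B :: "real poly poly"
  assumes "A * F + B * pderiv F = [:smult d (p * h):]" "d \<noteq> 0" "min_variance_sum N < real N / 2" "0 < N"
    and "L \<noteq> 0" "\<And>l. smult L (secular_poly N l) = map_poly (\<lambda>p. poly p l) F"
  shows "poly p (min_variance_sum N) = 0 \<or> poly h (min_variance_sum N) = 0"
proof -
  let ?c = "min_variance_sum N"
  obtain t where "poly (secular_poly N ?c) t = 0" "poly (pderiv (secular_poly N ?c)) t = 0"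
    by (rule min_variance_sum_double_root [OF assms(3,4)]) auto
  then have "poly (smult L (secular_poly N ?c)) t = 0" "poly (pderiv (smult L (secular_poly N ?c))) t = 0"
    by (simp_all add: pderiv_smult)
  then show ?thesis
    unfolding assms(6) by (rule common_root_elimination [OF assms(1,2)])
qed

text \<open>An even polynomial in \<open>s\<close> has a double root at 0 whenever its constant
  coefficient vanishes; passing to \<open>s\<^sup>2\<close> avoids these spurious solutions. The
  chain rule gives a factor \<open>2 t\<close>, cancelled by \<open>t \<noteq> 0\<close>.\<close>

lemma discriminant_vanishes_even:
  fixes F A B :: "real poly poly"
  assumes "A * F + B * pderiv F = [:smult d (p * h):]" "d \<noteq> 0" "min_variance_sum N < real N / 2" "0 < N"
    and "L \<noteq> 0" "\<And>l. smult L (secular_poly N l) = pcompose (map_poly (\<lambda>p. poly p l) F) [:0, 0, 1:]"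
  shows "poly p (min_variance_sum N) = 0 \<or> poly h (min_variance_sum N) = 0"
proof -
  let ?c = "min_variance_sum N"
  obtain t where "t \<noteq> 0" "poly (secular_poly N ?c) t = 0" "poly (pderiv (secular_poly N ?c)) t = 0"
    by (rule min_variance_sum_double_root [OF assms(3,4)]) auto
  then have "poly (smult L (secular_poly N ?c)) t = 0" "poly (pderiv (smult L (secular_poly N ?c))) t = 0"
    by (simp_all add: pderiv_smult)
  then have "poly (map_poly (\<lambda>p. poly p ?c) F) (t * t) = 0"
    "poly (pderiv (map_poly (\<lambda>p. poly p ?c) F)) (t * t) = 0"
    using \<open>t \<noteq> 0\<close> unfolding assms(6)
    by (simp_all add: poly_pcompose pderiv_pcompose) (simp add: pderiv_pCons)
  then show ?thesis
    by (rule common_root_elimination [OF assms(1,2)])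
qed

lemma poly_same_sign_coeffs:
  fixes p :: "real poly"
  assumes "p \<noteq> 0" "\<forall>a\<in>set (coeffs p). 0 < e * a" "0 \<le> x"
  shows "0 < e * poly p x"
  using assms(1,2)
proof (induction p)
  case (pCons a p)
  show ?case
  proof (cases "p = 0")
    case True
    then show ?thesis using pCons by (auto simp: coeffs_pCons_eq_cCons cCons_def)
  next
    case False
    then have "0 < e * poly p x" "0 < e * a"
      using pCons by (auto simp: coeffs_pCons_eq_cCons cCons_def)
    then have "0 < e * a + x * (e * poly p x)"
      using \<open>0 \<le> x\<close> by (simp add: add_pos_nonneg)
    then show ?thesis by (simp add: algebra_simps)
  qed
qed simp

text \<open>Substituting \<open>x = b - y\<close> maps the half-line to \<open>y \<ge> 0\<close>,
  where a polynomial whose coefficients all have the sign \<open>e\<close> cannot vanish.\<close>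

lemma no_root_below:
  fixes p :: "real poly"
  assumes "pcompose p [:b, -1:] \<noteq> 0" "\<forall>a\<in>set (coeffs (pcompose p [:b, -1:])). 0 < e * a" "x \<le> b"
  shows "poly p x \<noteq> 0"
  using poly_same_sign_coeffs [OF assms(1,2), of "b - x"] assms(3) by (auto simp: poly_pcompose)

section \<open>Explicit certificates for the eight spins\<close>

text \<open>In these bounds \<open>s\<close> is a rational near the double root. For
  \<open>N = 1\<close> and \<open>N = 2\<close> the bound only places the minimum below
  \<open>N / 2\<close>, as the linear polynomial gives the exact value; from \<open>N = 3\<close> on
  it also has to lie in the rounding interval.\<close>

lemma min_variance_sum_less_1: "min_variance_sum 1 < 7 / 27"
  by (rule min_variance_sum_less [where s = "1 / 2"])
     (simp_all add: secular_poly_def Let_def leading_minor_numeral leading_minor_1 diag_coeff_def)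

lemma min_variance_sum_root_1:
  "poly [:-1, 4:] (min_variance_sum 1) = 0"
proof -
  let ?F = "[:[:1, -2:],
      [:-2:],
      [:2:]:] :: real poly poly"
  let ?A = "[:[:-4:]:] :: real poly poly"
  let ?B = "[:[:-1:],
      [:2:]:] :: real poly poly"
  have bezout: "?A * ?F + ?B * pderiv ?F = [:smult 2 ([:-1, 4:] * 1):]"
    by (simp add: pderiv_pCons)
  have secular: "smult 2 (secular_poly 1 l) = map_poly (\<lambda>p. poly p l) ?F" for l
    by (simp add: secular_poly_def Let_def leading_minor_numeral leading_minor_1 diag_coeff_def
          map_poly_poly_pCons, (simp add: field_simps)?)
  have "poly [:-1, 4:] (min_variance_sum 1) = 0 \<or> poly 1 (min_variance_sum 1) = 0"
    by (rule discriminant_vanishes [OF bezout _ _ _ _ secular])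
       (use min_variance_sum_less_1 in simp_all)
  then show ?thesis by simp
qed

lemma min_variance_sum_less_2: "min_variance_sum 2 < 4 / 9"
  by (rule min_variance_sum_less [where s = "1"])
     (simp_all add: secular_poly_def Let_def leading_minor_numeral leading_minor_1 diag_coeff_def)

lemma min_variance_sum_root_2:
  "poly [:-7, 16:] (min_variance_sum 2) = 0"
proof -
  let ?F = "[:[:2, -3, 1:],
      [:-1, -2:],
      [:1:]:] :: real poly poly"
  let ?A = "[:[:-4:]:] :: real poly poly"
  let ?B = "[:[:-1, -2:],
      [:2:]:] :: real poly poly"
  have bezout: "?A * ?F + ?B * pderiv ?F = [:smult 1 ([:-7, 16:] * 1):]"
    by (simp add: pderiv_pCons)
  have secular: "smult 1 (secular_poly 2 l) = pcompose (map_poly (\<lambda>p. poly p l) ?F) [:0, 0, 1:]" for l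
    by (simp add: secular_poly_def Let_def leading_minor_numeral leading_minor_1 diag_coeff_def
          map_poly_poly_pCons, (simp add: field_simps)?)
  have "poly [:-7, 16:] (min_variance_sum 2) = 0 \<or> poly 1 (min_variance_sum 2) = 0"
    by (rule discriminant_vanishes_even [OF bezout _ _ _ _ secular])
       (use min_variance_sum_less_2 in simp_all)
  then show ?thesis by simp
qed

lemma min_variance_sum_less_3: "min_variance_sum 3 < 128 / 213"
  by (rule min_variance_sum_less [where s = "23 / 16"])
     (simp_all add: secular_poly_def Let_def leading_minor_numeral leading_minor_1 diag_coeff_def)

lemma min_variance_sum_root_3:
  "poly [:-181, 480, -336, 64:] (min_variance_sum 3) = 0"
proof -
  let ?F = "[:[:21, -20, 4:],
      [:-12, 8:],
      [:8, -8:],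
      [:-8:],
      [:4:]:] :: real poly poly"
  let ?A = "[:[:448, -968, 448:],
      [:156, -384, 192:],
      [:40, 160, -128:]:] :: real poly poly"
  let ?B = "[:[:60, 2, -76, 32:],
      [:-95, 194, -40, -32:],
      [:-34, 116, -64:],
      [:-10, -40, 32:]:] :: real poly poly"
  have bezout: "?A * ?F + ?B * pderiv ?F = [:smult 16 ([:-181, 480, -336, 64:] * [:-3, 2:]):]"
    by (simp add: pderiv_pCons)
  have secular: "smult 4 (secular_poly 3 l) = map_poly (\<lambda>p. poly p l) ?F" for l
    by (simp add: secular_poly_def Let_def leading_minor_numeral leading_minor_1 diag_coeff_def
          map_poly_poly_pCons, (simp add: field_simps)?)
  have "poly [:-181, 480, -336, 64:] (min_variance_sum 3) = 0
    \<or> poly [:-3, 2:] (min_variance_sum 3) = 0"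
    by (rule discriminant_vanishes [OF bezout _ _ _ _ secular])
       (use min_variance_sum_less_3 in simp_all)
  \<comment> \<open>The extra factor is a quarter of the linear coefficient of \<open>?F\<close>;
    its root \<open>3 / 2\<close> is \<open>diag_coeff 3 0\<close>.\<close>
  moreover have "poly [:-3, 2:] (min_variance_sum 3) \<noteq> 0"
    by (rule no_root_below [where b = "128 / 213" and e = "-1"])
       (use min_variance_sum_less_3 in simp_all)
  ultimately show ?thesis by blast
qed

lemma min_variance_sum_greater_3: "131 / 218 < min_variance_sum 3"
proof (rule ccontr)
  assume "\<not> 131 / 218 < min_variance_sum 3"
  then have "poly [:-181, 480, -336, 64:] (min_variance_sum 3) \<noteq> 0"
    \<comment> \<open>\<open>e\<close> is the sign of the polynomial towards minus infinity:
      \<open>-1\<close> for odd degree and \<open>1\<close> for even degree, here and for the larger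
      spins.\<close>
    by (intro no_root_below [where b = "131 / 218" and e = "-1"]) simp_all
  then show False using min_variance_sum_root_3 by blast
qed

lemma min_variance_sum_less_4: "min_variance_sum 4 < 422 / 563"
  by (rule min_variance_sum_less [where s = "44 / 23"])
     (simp_all add: secular_poly_def Let_def leading_minor_numeral leading_minor_1 diag_coeff_def)

lemma min_variance_sum_root_4:
  "poly [:-6487, 13404, -7104, 1024:] (min_variance_sum 4) = 0"
proof -
  let ?F = "[:[:60, -52, 13, -1:],
      [:4, -10, 3:],
      [:-3, -3:],
      [:1:]:] :: real poly poly"
  let ?A = "[:[:-846, 999, 144:],
      [:9, -144:]:] :: real poly poly"
  let ?B = "[:[:-284, 115, -131, 48:],
      [:285, -378, -96:],
      [:-3, 48:]:] :: real poly poly"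
  have bezout: "?A * ?F + ?B * pderiv ?F = [:smult 8 ([:-6487, 13404, -7104, 1024:] * 1):]"
    by (simp add: pderiv_pCons)
  have secular: "smult 1 (secular_poly 4 l) = pcompose (map_poly (\<lambda>p. poly p l) ?F) [:0, 0, 1:]" for l
    by (simp add: secular_poly_def Let_def leading_minor_numeral leading_minor_1 diag_coeff_def
          map_poly_poly_pCons, (simp add: field_simps)?)
  have "poly [:-6487, 13404, -7104, 1024:] (min_variance_sum 4) = 0 \<or> poly 1 (min_variance_sum 4) = 0"
    by (rule discriminant_vanishes_even [OF bezout _ _ _ _ secular])
       (use min_variance_sum_less_4 in simp_all)
  then show ?thesis by simp
qed

lemma min_variance_sum_greater_4: "419 / 559 < min_variance_sum 4"
proof (rule ccontr)
  assume "\<not> 419 / 559 < min_variance_sum 4"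
  then have "poly [:-6487, 13404, -7104, 1024:] (min_variance_sum 4) \<noteq> 0"
    by (intro no_root_below [where b = "419 / 559" and e = "-1"]) simp_all
  then show False using min_variance_sum_root_4 by blast
qed

lemma min_variance_sum_less_5: "min_variance_sum 5 < 166 / 187"
  by (rule min_variance_sum_less [where s = "43 / 18"])
     (simp_all add: secular_poly_def Let_def leading_minor_numeral leading_minor_1 diag_coeff_def)

lemma min_variance_sum_root_5:
  "poly [:-15158613241, 42609045676, -45976348848, 25301870144, -7743660032, 1323466752,
      -117440512, 4194304:] (min_variance_sum 5) = 0"
proof -
  let ?F = "[:[:1105, -742, 140, -8:],
      [:-390, 216, -24:],
      [:242, -176, 24:],
      [:-96, 48:],
      [:36, -24:],
      [:-24:],
      [:8:]:] :: real poly poly"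
  let ?A = "[:[:58729353542, -156414736128, 157213951464, -78340801408, 20688711168, -2791930368,
        161275904, -1769472:],
      [:15104325096, -39895574400, 37541891520, -16060562208, 2909558016, -20685312, -55590912,
        4718592:],
      [:-2664110808, 9608894592, -11833952448, 6556171200, -1640099328, 114281472, 18481152,
        -2359296:],
      [:-1314142260, 3970909920, -4688223072, 2735990016, -830009856, 123813888, -7077888:],
      [:734553384, -1241946048, 1146262848, -671262720, 224891904, -37552128, 2359296:]:] :: real poly poly"
  let ?B = "[:[:4707960465, -8255049666, 7163386812, -4483639608, 2132575104, -689727744, 134893056,
        -14032896, 589824:],
      [:-10091066116, 27084492612, -27221389536, 13687630496, -3826219296, 647576064, -78458368,
        7569408, -393216:],
      [:-2210241762, 6324647952, -5749184424, 1989735936, -41715072, -136034304, 30130176,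
        -1966080:],
      [:303900222, -1096399956, 1326888192, -645682944, 82934784, 30317568, -10027008, 786432:],
      [:280236492, -765313824, 876892416, -511936896, 157075968, -23764992, 1376256:],
      [:-122425564, 206991008, -191043808, 111877120, -37481984, 6258688, -393216:]:] :: real poly poly"
  have bezout: "?A * ?F + ?B * pderiv ?F = [:smult 64 ([:-15158613241, 42609045676, -45976348848, 25301870144, -7743660032, 1323466752,
      -117440512, 4194304:] * [:-65, 36, -4:]):]"
    by (simp add: pderiv_pCons)
  have secular: "smult 8 (secular_poly 5 l) = map_poly (\<lambda>p. poly p l) ?F" for l
    by (simp add: secular_poly_def Let_def leading_minor_numeral leading_minor_1 diag_coeff_def
          map_poly_poly_pCons, (simp add: field_simps)?)
  have "poly [:-15158613241, 42609045676, -45976348848, 25301870144, -7743660032, 1323466752,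
      -117440512, 4194304:] (min_variance_sum 5) = 0
    \<or> poly [:-65, 36, -4:] (min_variance_sum 5) = 0"
    by (rule discriminant_vanishes [OF bezout _ _ _ _ secular])
       (use min_variance_sum_less_5 in simp_all)
  \<comment> \<open>The roots \<open>5 / 2\<close> and \<open>13 / 2\<close> are
    \<open>diag_coeff 5 0\<close> and \<open>diag_coeff 5 1\<close>.\<close>
  moreover have "poly [:-65, 36, -4:] (min_variance_sum 5) \<noteq> 0"
    by (rule no_root_below [where b = "166 / 187" and e = "-1"])
       (use min_variance_sum_less_5 in simp_all)
  ultimately show ?thesis by blast
qed

lemma min_variance_sum_greater_5: "245 / 276 < min_variance_sum 5"
proof (rule ccontr)
  assume "\<not> 245 / 276 < min_variance_sum 5"
  then have "poly [:-15158613241, 42609045676, -45976348848, 25301870144, -7743660032, 1323466752,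
      -117440512, 4194304:] (min_variance_sum 5) \<noteq> 0"
    by (intro no_root_below [where b = "245 / 276" and e = "-1"]) simp_all
  then show False using min_variance_sum_root_5 by blast
qed

lemma min_variance_sum_less_6: "min_variance_sum 6 < 56 / 55"
  by (rule min_variance_sum_less [where s = "20 / 7"])
     (simp_all add: secular_poly_def Let_def leading_minor_numeral leading_minor_1 diag_coeff_def)

lemma min_variance_sum_root_6:
  "poly [:1179352998, -2397898539, 1709341632, -574842880, 98042880, -8159232, 262144:] (min_variance_sum 6) = 0"
proof -
  let ?F = "[:[:3168, -2004, 409, -34, 1:],
      [:276, -266, 62, -4:],
      [:1, -22, 6:],
      [:-6, -4:],
      [:1:]:] :: real poly poly"
  let ?A = "[:[:106470068, -150904670, 48075580, -2984192, 18944, -40960:],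
      [:-6802914, 11838088, -5239296, 248832, 81920:],
      [:462268, -429312, 256512, -40960:]:] :: real poly poly"
  let ?B = "[:[:8538000, 11262100, -12702541, 5578447, -1404544, 194176, -10240:],
      [:-28446316, 42105262, -12769869, 748096, -116608, 30720:],
      [:1874079, -3004947, 1298688, -13440, -30720:],
      [:-115567, 107328, -64128, 10240:]:] :: real poly poly"
  have bezout: "?A * ?F + ?B * pderiv ?F = [:smult 288 ([:1179352998, -2397898539, 1709341632, -574842880, 98042880, -8159232, 262144:] * 1):]"
    by (simp add: pderiv_pCons)
  have secular: "smult 1 (secular_poly 6 l) = pcompose (map_poly (\<lambda>p. poly p l) ?F) [:0, 0, 1:]" for l
    by (simp add: secular_poly_def Let_def leading_minor_numeral leading_minor_1 diag_coeff_def
          map_poly_poly_pCons, (simp add: field_simps)?)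
  have "poly [:1179352998, -2397898539, 1709341632, -574842880, 98042880, -8159232, 262144:] (min_variance_sum 6) = 0 \<or> poly 1 (min_variance_sum 6) = 0"
    by (rule discriminant_vanishes_even [OF bezout _ _ _ _ secular])
       (use min_variance_sum_less_6 in simp_all)
  then show ?thesis by simp
qed

lemma min_variance_sum_greater_6: "58 / 57 < min_variance_sum 6"
proof (rule ccontr)
  assume "\<not> 58 / 57 < min_variance_sum 6"
  then have "poly [:1179352998, -2397898539, 1709341632, -574842880, 98042880, -8159232, 262144:] (min_variance_sum 6) \<noteq> 0"
    by (intro no_root_below [where b = "58 / 57" and e = "1"]) simp_all
  then show False using min_variance_sum_root_6 by blast
qed

lemma min_variance_sum_less_7: "min_variance_sum 7 < 129 / 113"
  by (rule min_variance_sum_less [where s = "57 / 17"])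
     (simp_all add: secular_poly_def Let_def leading_minor_numeral leading_minor_1 diag_coeff_def)

lemma min_variance_sum_root_7:
  "poly [:-67745907126251250695, 203719751641654010210, -263781099083569171968,
      197231954550318498240, -95672589723220763904, 31923050400995246592, -7558113438967267328,
      1288197712964943872, -158338610153127936, 13886438674268160, -846111845646336,
      33978291585024, -807453851648, 8589934592:] (min_variance_sum 7) = 0"
proof -
  let ?F = "[:[:111321, -58952, 9912, -672, 16:],
      [:-28728, 13360, -1696, 64:],
      [:17120, -9808, 1472, -64:],
      [:-4624, 2176, -192:],
      [:1576, -928, 96:],
      [:-480, 192:],
      [:128, -64:],
      [:-64:],
      [:16:]:] :: real poly poly"
  let ?A = "[:[:80914674927617165020536, -237370584290983721619408, 298125971878899913292672,
        -214691016098956137996160, 99391701872590190172032, -31273867351210637795584,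
        6869623020279941929984, -1061581891429729341440, 114287786563014672384, -8289259086799044608,
        372784018386583552, -7943587975135232, -62454998499328, 6488084971520, -85899345920:],
      [:17923525745554535568912, -52336033154507970105472, 64853768596163657730688,
        -45784597619027340259328, 20680667763600977016064, -6336392988846789146624,
        1361479018553706586112, -210092447128899829760, 23956181090987606016, -2120627079027097600,
        156068351213305856, -9795030457778176, 478448887791616, -15001247023104, 214748364800:],
      [:-5243676162216869106432, 16659576845476514098432, -22620842062625473071744,
        17543110473488619986176, -8710275479125696020992, 2930528697660910218240,
        -688452640057953964032, 114705030016209010688, -13682933507805741056, 1185511329626062848,
        -77448296712372224, 4082696791785472, -178368381190144, 5596342386688, -85899345920:],
      [:-1151747129726554727232, 3494891329657421852928, -4549540011497277478144,
        3357857678658987220992, -1556471928909686583296, 470763477089993801728,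
        -92143168076260147200, 10671452967304429568, -419019262384406528, -71782569439395840,
        13272912219865088, -1002873253003264, 38235946352640, -601295421440:],
      [:243206019933120088416, -686960252326251309248, 853570774552815965568,
        -618055776852606368000, 288345470615651177472, -89771408866707173376, 18465328586437640192,
        -2309227417250299904, 112188391818264576, 13984933584306176, -3049226124656640,
        250954402234368, -10264971837440, 171798691840:],
      [:54506964160414051776, -170727060204147305728, 231158975564929456896,
        -181921682150832130048, 93282498218367623168, -32887201234732269568, 8171555379509264384,
        -1440394546550407168, 178587342158692352, -15177954107588608, 839057563189248,
        -27091579961344, 386547056640:],
      [:-460395046537327872, 16300767922354184448, -31052368751401387008, 27622867454959813632,
        -14954684752426987520, 5453091433254404096, -1398920038916882432, 255839388461694976,
        -33095334976552960, 2945344891518976, -170664283602944, 5768141078528, -85899345920:]:] :: real poly poly"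
  let ?B = "[:[:1371225306750751252017, -1299067294724533482660, -922517473603650014588,
        2385666214687626831632, -2043694663575258653968, 1067254793697327295040,
        -389530685373733419840, 104979476982274681600, -21363669796499338240, 3295883808927715328,
        -382030541790543872, 32594559623495680, -1976863473795072, 80337497489408, -1954881208320,
        21474836480:],
      [:-9826692331403638950642, 28363002529354273844352, -34704081394018296961992,
        24050468955848433972384, -10518383365839273019104, 3027206807050739081984,
        -569302673118382391680, 63243292781875339776, -1817962843918419968, -664643456011968512,
        131146621933191168, -13173134345633792, 847005525999616, -35639437295616, 908922454016,
        -10737418240:],
      [:-2397196804307154605514, 7244268838385935340444, -9155826079559179975808,
        6562373355268012776416, -3020283114600507941408, 956964806346243762112,
        -219836097810811674880, 38551899461279149056, -5447838845452636160, 642061433801768960,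
        -61983623766081536, 4566683492548608, -232215728357376, 7087635562496, -96636764160:],
      [:626846708228186316744, -1992893135159431867704, 2723167369808601535392,
        -2132251571636486474304, 1073265780826834872448, -368949665455932121472,
        89976746228164626944, -16050739161059764224, 2166192687318261760, -230316953107824640,
        19902283691065344, -1375597972422656, 69774495186944, -2218887479296, 32212254720:],
      [:157040998148099808180, -452649345088125397872, 565868469887237206752,
        -400256713484753122944, 174865373898802376256, -47675709506532370176, 7356906589935571968,
        -263382148667019264, -140760790627221504, 33291389750476800, -3746402553298944,
        241423601369088, -8538260766720, 128849018880:],
      [:-26979679886409841320, 74632641899631472800, -89240928332518338240, 61142106270256120320,
        -26292835357925100672, 7126231329825056256, -1072091181712422912, 15768782242848768,
        30152312683364352, -6925697729691648, 807095733583872, -54575813885952, 2030982660096,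
        -32212254720:],
      [:-6842145210460339464, 22359680520665549744, -30835644992578768800, 24466639484789004608,
        -12594980074322639616, 4451718368919933952, -1108876924870963200, 196039280097656832,
        -24391876205871104, 2081328319168512, -115548713123840, 3746956312576, -53687091200:],
      [:57549380817165984, -2037595990294273056, 3881546093925173376, -3452858431869976704,
        1869335594053373440, -681636429156800512, 174865004864610304, -31979923557711872,
        4136916872069120, -368168111439872, 21333035450368, -721017634816, 10737418240:]:] :: real poly poly"
  have bezout: "?A * ?F + ?B * pderiv ?F = [:smult 36864 ([:-67745907126251250695, 203719751641654010210, -263781099083569171968,
      197231954550318498240, -95672589723220763904, 31923050400995246592, -7558113438967267328,
      1288197712964943872, -158338610153127936, 13886438674268160, -846111845646336,
      33978291585024, -807453851648, 8589934592:] * [:-3591, 1670, -212, 8:]):]"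
    by (simp add: pderiv_pCons)
  have secular: "smult 16 (secular_poly 7 l) = map_poly (\<lambda>p. poly p l) ?F" for l
    by (simp add: secular_poly_def Let_def leading_minor_numeral leading_minor_1 diag_coeff_def
          map_poly_poly_pCons, (simp add: field_simps)?)
  have "poly [:-67745907126251250695, 203719751641654010210, -263781099083569171968,
      197231954550318498240, -95672589723220763904, 31923050400995246592, -7558113438967267328,
      1288197712964943872, -158338610153127936, 13886438674268160, -846111845646336,
      33978291585024, -807453851648, 8589934592:] (min_variance_sum 7) = 0
    \<or> poly [:-3591, 1670, -212, 8:] (min_variance_sum 7) = 0"
    by (rule discriminant_vanishes [OF bezout _ _ _ _ secular])
       (use min_variance_sum_less_7 in simp_all)
  \<comment> \<open>The roots \<open>7 / 2\<close>, \<open>19 / 2\<close> and \<open>27 / 2\<close>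
    are \<open>diag_coeff 7 k\<close> for \<open>k = 0, 1, 2\<close>.\<close>
  moreover have "poly [:-3591, 1670, -212, 8:] (min_variance_sum 7) \<noteq> 0"
    by (rule no_root_below [where b = "129 / 113" and e = "-1"])
       (use min_variance_sum_less_7 in simp_all)
  ultimately show ?thesis by blast
qed

lemma min_variance_sum_greater_7: "121 / 106 < min_variance_sum 7"
proof (rule ccontr)
  assume "\<not> 121 / 106 < min_variance_sum 7"
  then have "poly [:-67745907126251250695, 203719751641654010210, -263781099083569171968,
      197231954550318498240, -95672589723220763904, 31923050400995246592, -7558113438967267328,
      1288197712964943872, -158338610153127936, 13886438674268160, -846111845646336,
      33978291585024, -807453851648, 8589934592:] (min_variance_sum 7) \<noteq> 0"
    by (intro no_root_below [where b = "121 / 106" and e = "-1"]) simp_all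
  then show False using min_variance_sum_root_7 by blast
qed

lemma min_variance_sum_less_8: "min_variance_sum 8 < 92 / 73"
  by (rule min_variance_sum_less [where s = "23 / 6"])
     (simp_all add: secular_poly_def Let_def leading_minor_numeral leading_minor_1 diag_coeff_def)

lemma min_variance_sum_root_8:
  "poly [:79926677043771116, -163205035294297553, 132277607024648928, -57914832267046937,
      15404738985045728, -2624974965550080, 292217512296448, -21110360768512, 952177262592,
      -24326963200, 268435456:] (min_variance_sum 8) = 0"
proof -
  let ?F = "[:[:267520, -135376, 23560, -1873, 70, -1:],
      [:21456, -14032, 2707, -200, 5:],
      [:712, -819, 180, -10:],
      [:-15, -40, 10:],
      [:-10, -5:],
      [:1:]:] :: real poly poly"
  let ?A = "[:[:5460124281319728, -8394198008387920, 4298334571478545, -979613736374060, 99543796759895,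
        -2651718459116, -271489337600, 28034923520, -1554022400, 45875200:],
      [:-347662823860660, 586634704451975, -345245510785560, 91134342572435, -11121419758780,
        579119696640, -21815587840, 2709094400, -137625600:],
      [:13682030556080, -22087580096080, 12761088260885, -3476728870340, 412454176000, -6160256000,
        -2538700800, 137625600:],
      [:-146153208940, 445303698945, -292135911060, 93316839680, -15955491840, 1383628800,
        -45875200:]:] :: real poly poly"
  let ?B = "[:[:583336294376192, -709554425332304, 545364999060104, -272393271408869, 87497493052770,
        -18503978667469, 2644852562692, -256505978112, 16138554368, -586055680, 9175040:],
      [:-1164072465696496, 1787486172571996, -873482259444230, 176057968851426, -11037041282060,
        -1164731638160, 257774189568, -23861178368, 1384775680, -36700160:],
      [:74362302875228, -122401611079469, 71300567106834, -18524418146638, 2220943457944,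
        -131824387584, 10768959488, -1288110080, 55050240:],
      [:-2794867394792, 4566406857006, -2580011276812, 674245327728, -70209664000, -1405595648,
        766115840, -36700160:],
      [:29230641788, -89060739789, 58427182212, -18663367936, 3191098368, -276725760, 9175040:]:] :: real poly poly"
  have bezout: "?A * ?F + ?B * pderiv ?F = [:smult 18432 ([:79926677043771116, -163205035294297553, 132277607024648928, -57914832267046937,
      15404738985045728, -2624974965550080, 292217512296448, -21110360768512, 952177262592,
      -24326963200, 268435456:] * 1):]"
    by (simp add: pderiv_pCons)
  have secular: "smult 1 (secular_poly 8 l) = pcompose (map_poly (\<lambda>p. poly p l) ?F) [:0, 0, 1:]" for l
    by (simp add: secular_poly_def Let_def leading_minor_numeral leading_minor_1 diag_coeff_def
          map_poly_poly_pCons, (simp add: field_simps)?)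
  have "poly [:79926677043771116, -163205035294297553, 132277607024648928, -57914832267046937,
      15404738985045728, -2624974965550080, 292217512296448, -21110360768512, 952177262592,
      -24326963200, 268435456:] (min_variance_sum 8) = 0 \<or> poly 1 (min_variance_sum 8) = 0"
    by (rule discriminant_vanishes_even [OF bezout _ _ _ _ secular])
       (use min_variance_sum_less_8 in simp_all)
  then show ?thesis by simp
qed

lemma min_variance_sum_greater_8: "63 / 50 < min_variance_sum 8"
proof (rule ccontr)
  assume "\<not> 63 / 50 < min_variance_sum 8"
  then have "poly [:79926677043771116, -163205035294297553, 132277607024648928, -57914832267046937,
      15404738985045728, -2624974965550080, 292217512296448, -21110360768512, 952177262592,
      -24326963200, 268435456:] (min_variance_sum 8) \<noteq> 0"
    by (intro no_root_below [where b = "63 / 50" and e = "1"]) simp_all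
  then show False using min_variance_sum_root_8 by blast
qed

section \<open>Irreducibility from prime values\<close>

lemma norm_poly_le:
  fixes z :: complex
  assumes "norm z \<le> of_int k"
  shows "norm (poly (of_int_poly q) z) \<le> of_int (poly (map_poly abs q) k)"
proof (induction q)
  case (pCons a q)
  have "norm (poly (of_int_poly (pCons a q)) z) \<le> \<bar>of_int a\<bar> + norm z * norm (poly (of_int_poly q) z)"
    using pCons.hyps by (simp add: map_poly_pCons norm_mult) (metis norm_mult norm_of_int norm_triangle_ineq)
  also have "\<dots> \<le> \<bar>of_int a\<bar> + of_int k * of_int (poly (map_poly abs q) k)"
    using pCons.IH assms order_trans [OF norm_ge_zero assms] by (intro add_left_mono mult_mono) auto
  finally show ?case using pCons.hyps by (simp add: map_poly_pCons)
qed simp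

text \<open>At a root in the disc the constant coefficient would be bounded by the remaining terms
  taken absolutely at radius \<open>k\<close>. The factor 2 appears because
  \<open>map_poly abs Q\<close> contains the constant coefficient as well.\<close>

lemma root_outside_disc:
  fixes z :: complex
  assumes "poly (of_int_poly Q) z = 0" "poly (map_poly abs Q) k < 2 * \<bar>poly Q 0\<bar>"
  shows "of_int k < norm z"
proof (rule ccontr)
  assume "\<not> of_int k < norm z"
  then have z: "norm z \<le> of_int k" by simp
  then have k: "(0 :: real) \<le> of_int k" by (rule order_trans [OF norm_ge_zero])
  obtain a q where Q: "Q = pCons a q" by (cases Q)
  show False
  proof (cases "Q = 0")
    case False
    have "of_int a = - (z * poly (of_int_poly q) z)"
      using assms(1) False by (simp add: Q map_poly_pCons eq_neg_iff_add_eq_0)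
    then have "\<bar>real_of_int a\<bar> = norm z * norm (poly (of_int_poly q) z)"
      by (metis norm_minus_cancel norm_mult norm_of_int)
    also have "\<dots> \<le> of_int k * of_int (poly (map_poly abs q) k)"
      by (intro mult_mono z norm_poly_le k) auto
    finally have "\<bar>a\<bar> \<le> k * poly (map_poly abs q) k"
      by (simp only: of_int_abs [symmetric] of_int_mult [symmetric] of_int_le_iff)
    then show False
      using assms(2) False by (simp add: Q map_poly_pCons)
  qed (use assms in simp)
qed

text \<open>Over the complex numbers \<open>g\<close> at \<open>m\<close> is the leading
  coefficient, at least 1 in absolute value, times a nonempty product of distances to roots, each
  larger than \<open>k \<ge> 1\<close>.\<close>

lemma abs_poly_gt:
  fixes g :: "int poly"
  assumes "degree g \<noteq> 0" "1 \<le> k"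
    and far: "\<And>z :: complex. poly (of_int_poly g) z = 0 \<Longrightarrow> of_int k < norm (of_int m - z)"
  shows "k < \<bar>poly g m\<bar>"
proof -
  let ?G = "of_int_poly g :: complex poly"
  obtain as where as: "smult (lead_coeff ?G) (\<Prod>a\<leftarrow>as. [:- a, 1:]) = ?G" "length as = degree ?G"
    using fundamental_theorem_algebra_factorized [of ?G] by auto
  have root: "poly ?G a = 0" if "a \<in> set as" for a
    using that by (subst as(1) [symmetric]) (auto simp: poly_prod_list prod_list_zero_iff)
  have "as \<noteq> []" using as(2) assms(1) by auto
  have big: "of_int k < norm (\<Prod>a\<leftarrow>as. of_int m - a)"
    using \<open>as \<noteq> []\<close> far [OF root]
  proof (induction as rule: list_nonempty_induct)
    case (cons a as)
    have "of_int k < norm (of_int m - a)" "of_int k < norm (\<Prod>a\<leftarrow>as. of_int m - a)"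
      using cons by simp_all
    moreover have "(1 :: real) \<le> of_int k" using assms(2) by simp
    ultimately have "of_int k * 1 < norm (of_int m - a) * norm (\<Prod>a\<leftarrow>as. of_int m - a)"
      by (intro mult_strict_mono) auto
    then show ?case by (simp add: norm_mult)
  qed simp
  have "g \<noteq> 0" using assms(1) by auto
  then have "1 \<le> \<bar>lead_coeff g\<bar>"
    by (simp add: int_one_le_iff_zero_less)
  then have lc: "1 \<le> \<bar>real_of_int (lead_coeff g)\<bar>" by linarith
  have "of_int (poly g m) = poly ?G (of_int m)"
    by simp
  also have "\<dots> = of_int (lead_coeff g) * (\<Prod>a\<leftarrow>as. of_int m - a)"
    by (subst as(1) [symmetric]) (simp add: poly_prod_list o_def)
  finally have "norm (of_int (poly g m) :: complex) = norm (of_int (lead_coeff g) * (\<Prod>a\<leftarrow>as. of_int m - a))"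
    by simp
  then have "\<bar>real_of_int (poly g m)\<bar> = \<bar>real_of_int (lead_coeff g)\<bar> * norm (\<Prod>a\<leftarrow>as. of_int m - a)"
    by (simp only: norm_mult norm_of_int)
  also have "\<dots> \<ge> 1 * norm (\<Prod>a\<leftarrow>as. of_int m - a)"
    by (intro mult_right_mono lc) simp
  finally have "real_of_int k < \<bar>real_of_int (poly g m)\<bar>" using big by simp
  then show ?thesis by linarith
qed

section \<open>Integer polynomials of least degree with a given real root\<close>

text \<open>Gauss's lemma: contents multiply, so \<open>a\<close> divides the content of the
  cofactor and can be cancelled.\<close>

lemma primitive_dvd_smult:
  fixes f g :: "int poly"
  assumes "content f = 1" "f dvd smult a g" "a \<noteq> 0"
  shows "f dvd g"
proof -
  obtain s where s: "smult a g = f * s" using assms(2) by (auto simp: dvd_def)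
  have "content s = \<bar>a\<bar> * content g"
    using arg_cong [OF s, of content] assms(1) by (simp add: content_mult)
  then have "s = smult a (smult (sgn a * content g) (primitive_part s))"
    using content_times_primitive_part [of s]
    by (simp only: smult_smult abs_sgn mult.assoc)
  then have "smult a g = smult a (f * smult (sgn a * content g) (primitive_part s))"
    using s by (metis mult_smult_right)
  then have "g = f * smult (sgn a * content g) (primitive_part s)"
    using assms(3) by (simp only: poly_eq_iff coeff_smult mult_cancel_left) simp
  then show ?thesis by (rule dvdI)
qed

lemma real_root_primitive_part:
  assumes "poly (of_int_poly q) (x :: real) = 0" "q \<noteq> 0"
  shows "poly (of_int_poly (primitive_part q)) x = 0"
proof -
  have "poly (of_int_poly (smult (content q) (primitive_part q))) x = 0"
    using assms(1) by simp
  then show ?thesis using assms(2) by (simp only: of_int_hom.map_poly_hom_smult poly_smult) simp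
qed

text \<open>The factor is a least-degree annihilator of \<open>x\<close>, made primitive. The
  pseudo-remainder of \<open>P\<close> also annihilates \<open>x\<close>, so minimality makes it 0,
  and Gauss's lemma removes the multiplier of the pseudo-division.\<close>

lemma minimal_primitive_factor:
  fixes P q :: "int poly" and x :: real
  assumes "poly (of_int_poly P) x = 0" "poly (of_int_poly q) x = 0" "q \<noteq> 0"
  obtains f where "f dvd P" "f \<noteq> 0" "poly (of_int_poly f) x = 0" "degree f \<le> degree q"
proof -
  let ?R = "\<lambda>q. q \<noteq> 0 \<and> poly (of_int_poly q) x = 0"
  obtain g where g: "?R g" "\<And>r. ?R r \<Longrightarrow> degree g \<le> degree r"
    using ex_has_least_nat [of ?R q degree] assms by auto
  define f where "f = primitive_part g"
  have f: "f \<noteq> 0" "content f = 1" "degree f = degree g" "poly (of_int_poly f) x = 0"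
    using g(1) real_root_primitive_part [of g x] by (auto simp: f_def)
  obtain a s where as: "a \<noteq> 0" "smult a P = f * s + pseudo_mod P f"
    and deg: "pseudo_mod P f = 0 \<or> degree (pseudo_mod P f) < degree f"
    using pseudo_mod [OF f(1), of P] by auto
  have "of_int_poly (smult a P) = (of_int_poly f * of_int_poly s + of_int_poly (pseudo_mod P f) :: real poly)"
    by (subst as(2)) (simp add: hom_distribs)
  from arg_cong [OF this, of "\<lambda>p. poly p x"]
  have "poly (of_int_poly (pseudo_mod P f)) x = 0"
    using assms(1) f(4) by (simp add: hom_distribs)
  then have "pseudo_mod P f = 0"
    using deg g(2) [of "pseudo_mod P f"] f(3) by fastforce
  then have "f dvd smult a P" using as(2) by simp
  then have "f dvd P" using primitive_dvd_smult f(2) as(1) by blast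
  then show ?thesis using that f g(2) [of q] assms by auto
qed

text \<open>Murty's irreducibility argument: all roots of \<open>P\<close> have distance more than \<open>k\<close> from \<open>m\<close>, so every
  nonconstant factor of \<open>P\<close> has absolute value more than \<open>k\<close> at \<open>m\<close>, which is impossible for two
  complementary factors when \<open>P(m)\<close> is \<open>k\<close> times a prime. The distance is read off from
  \<open>P(m + x) P(m - x)\<close>, a polynomial in \<open>x\<^sup>2\<close>, because there the constant coefficient dominates
  for smaller \<open>\<bar>m\<bar>\<close> (a Graeffe step).\<close>

lemma no_lower_degree_annihilator:
  fixes P q :: "int poly" and x :: real
  assumes root: "poly (of_int_poly P) x = 0"
    and p: "prime p" "\<bar>poly P m\<bar> = k * p" and k: "1 \<le> k"
    and disc: "poly (map_poly abs (pcompose P [:m, 1:] * pcompose P [:m, -1:])) k < 2 * \<bar>poly P m * poly P m\<bar>"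
    and q: "q \<noteq> 0" "degree q < degree P"
  shows "poly (of_int_poly q) x \<noteq> 0"
proof
  assume "poly (of_int_poly q) x = 0"
  then obtain f where f: "f dvd P" "f \<noteq> 0" "poly (of_int_poly f) x = 0" "degree f \<le> degree q"
    using minimal_primitive_factor [OF root] q(1) by blast
  then obtain g where g: "P = f * g" by (auto simp: dvd_def)
  have "P \<noteq> 0" using q(2) by auto
  have "degree f \<noteq> 0"
  proof
    assume "degree f = 0"
    then obtain a where "f = [:a:]" by (rule degree_eq_zeroE)
    then show False using f(2,3) by simp
  qed
  moreover have "degree g \<noteq> 0"
    using \<open>P \<noteq> 0\<close> f(4) q(2) by (auto simp: g degree_mult_eq)
  moreover have far: "of_int k < norm (of_int m - z)" if "poly (of_int_poly P) z = 0" for z :: complex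
  proof -
    \<comment> \<open>A root \<open>z\<close> of \<open>P\<close> becomes the root
      \<open>z - m\<close> of \<open>?T\<close>, whose constant coefficient is the square of
      \<open>P\<close> at \<open>m\<close>.\<close>
    let ?T = "pcompose P [:m, 1:] * pcompose P [:m, -1:]"
    have "poly (of_int_poly ?T) (z - of_int m) = 0"
      using that by (simp add: of_int_hom.map_poly_pcompose poly_pcompose map_poly_pCons hom_distribs)
    moreover have "poly ?T 0 = poly P m * poly P m" by (simp add: poly_pcompose)
    ultimately have "of_int k < norm (z - of_int m)"
      using disc by (intro root_outside_disc [where Q = ?T]) simp_all
    then show ?thesis by (simp add: norm_minus_commute)
  qed
  ultimately have gt: "k < \<bar>poly f m\<bar>" "k < \<bar>poly g m\<bar>"
    using k by (auto intro!: abs_poly_gt simp: g hom_distribs)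
  have prod: "\<bar>poly f m\<bar> * \<bar>poly g m\<bar> = k * p" using p(2) by (simp add: g abs_mult)
  \<comment> \<open>If \<open>p\<close> divided \<open>u\<close>, the other factor \<open>v\<close>
    would divide \<open>k\<close>, although it exceeds \<open>k\<close>.\<close>
  have ndvd: "\<not> p dvd u" if "u * v = k * p" "k < v" "k < u" for u v
  proof
    assume "p dvd u"
    then obtain w where w: "u = p * w" by (auto simp: dvd_def)
    have "0 < p" using p(1) by (rule prime_gt_0_int)
    have "p * (w * v) = p * k" using that(1) by (simp add: w mult_ac)
    then have "w * v = k" using \<open>0 < p\<close> by simp
    moreover have "0 < p * w" using that(3) k w by simp
    then have "1 \<le> w" using \<open>0 < p\<close> by (simp add: zero_less_mult_iff)
    then have "1 * v \<le> w * v" using that(2) k by (intro mult_right_mono) auto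
    ultimately show False using that(2) by simp
  qed
  have "\<not> p dvd \<bar>poly f m\<bar>" using ndvd [OF prod] gt by blast
  moreover have "\<not> p dvd \<bar>poly g m\<bar>"
    using ndvd [of "\<bar>poly g m\<bar>" "\<bar>poly f m\<bar>"] prod gt by (simp add: mult.commute)
  moreover have "p dvd \<bar>poly f m\<bar> * \<bar>poly g m\<bar>" unfolding prod by simp
  ultimately show False using p(1) by (auto dest: prime_dvd_multD)
qed


text \<open>The factors \<open>b ^ (d - i)\<close> compensate the scaling of the root and leave the
  leading coefficient unchanged.\<close>

lemma rescaled_annihilator:
  fixes q :: "int poly" and x :: real
  assumes "q \<noteq> 0" "poly (of_int_poly q) x = 0" "0 < b"
  obtains r where "r \<noteq> 0" "degree r \<le> degree q" "poly (of_int_poly r) (of_int b * x) = 0"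
proof -
  define d where "d = degree q"
  define r where "r = (\<Sum>i\<le>d. Polynomial.monom (Polynomial.coeff q i * b ^ (d - i)) i)"
  have "Polynomial.coeff r d = lead_coeff q"
    by (simp add: r_def coeff_sum sum.delta d_def cong: if_cong)
  then have "r \<noteq> 0" using assms(1) by (metis coeff_0 leading_coeff_0_iff)
  moreover have "degree r \<le> d"
    unfolding r_def by (intro degree_sum_le) (auto intro: order_trans [OF degree_monom_le])
  moreover have "poly (of_int_poly r) (of_int b * x) = 0"
  proof -
    have "poly (of_int_poly r) (of_int b * x)
        = (\<Sum>i\<le>d. of_int (Polynomial.coeff q i * b ^ (d - i)) * (of_int b * x) ^ i)"
      unfolding r_def by (simp add: hom_distribs poly_sum poly_monom)
    also have "\<dots> = (\<Sum>i\<le>d. of_int b ^ d * (of_int (Polynomial.coeff q i) * x ^ i))"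
    proof (intro sum.cong refl)
      fix i assume "i \<in> {..d}"
      then have "of_int b ^ d = (of_int b ^ (d - i) * of_int b ^ i :: real)"
        by (simp add: power_add [symmetric])
      then show "of_int (Polynomial.coeff q i * b ^ (d - i)) * (of_int b * x) ^ i
          = of_int b ^ d * (of_int (Polynomial.coeff q i) * x ^ i)"
        by (simp add: power_mult_distrib)
    qed
    also have "\<dots> = of_int b ^ d * poly (of_int_poly q) x"
      by (simp add: poly_altdef d_def sum_distrib_left)
    finally show ?thesis using assms(2) by simp
  qed
  ultimately show ?thesis using that by (simp add: d_def)
qed

text \<open>\<open>Q\<close> at \<open>m\<close> is \<open>e\<close> times \<open>P\<close> at
  \<open>m / b\<close>. So test points with denominator \<open>b\<close> are allowed, the disc free
  of roots of \<open>P\<close> needs only radius \<open>k / b\<close>, and powers of 2 in the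
  leading coefficient are absorbed.\<close>

lemma no_lower_degree_annihilator_scaled:
  fixes P Q q :: "int poly" and x :: real
  assumes root: "poly (of_int_poly P) x = 0"
    and scale: "pcompose Q [:0, b:] = smult e P" "0 < b" "e \<noteq> 0"
    and p: "prime p" "\<bar>poly Q m\<bar> = k * p" and k: "1 \<le> k"
    and disc: "poly (map_poly abs (pcompose Q [:m, 1:] * pcompose Q [:m, -1:])) k < 2 * \<bar>poly Q m * poly Q m\<bar>"
    and q: "q \<noteq> 0" "degree q < degree P"
  shows "poly (of_int_poly q) x \<noteq> 0"
proof
  assume "poly (of_int_poly q) x = 0"
  then obtain r where r: "r \<noteq> 0" "degree r \<le> degree q" "poly (of_int_poly r) (of_int b * x) = 0"
    using rescaled_annihilator q(1) scale(2) by blast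
  have "degree P = degree Q"
    using arg_cong [OF scale(1), of degree] scale(2,3) by (simp add: degree_pcompose)
  moreover have "poly (of_int_poly Q) (of_int b * x) = 0"
  proof -
    have "poly (of_int_poly Q) (of_int b * x) = poly (of_int_poly (pcompose Q [:0, b:])) x"
      using scale(2) by (simp add: of_int_hom.map_poly_pcompose poly_pcompose map_poly_pCons mult.commute)
    then show ?thesis using root by (simp add: scale(1) hom_distribs)
  qed
  ultimately have "poly (of_int_poly r) (of_int b * x) \<noteq> 0"
    using q(2) r(1,2) by (intro no_lower_degree_annihilator [OF _ p k disc]) auto
  then show False using r(3) by simp
qed

section \<open>Primality certificates by Pocklington's criterion\<close>

text \<open>Each step carries the quotient of the reduction, so that running the chain needs no division.\<close>

primrec squaring_chain :: "int \<Rightarrow> int \<Rightarrow> nat \<times> int \<Rightarrow> (nat \<times> int) list \<Rightarrow> nat \<times> int" where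
  "squaring_chain n a ex [] = ex"
| "squaring_chain n a ex (dq # ws) =
     squaring_chain n a (2 * fst ex + fst dq, snd ex * snd ex * a ^ fst dq - snd dq * n) ws"

lemma squaring_chain_cong:
  assumes "squaring_chain n a (e, x) ws = (e', x')" "[a ^ e = x] (mod n)"
  shows "[a ^ e' = x'] (mod n)"
  using assms
proof (induction ws arbitrary: e x)
  case (Cons dq ws)
  have "[a ^ e * a ^ e * a ^ fst dq - 0 = x * x * a ^ fst dq - snd dq * n] (mod n)"
    using Cons.prems(2) by (intro cong_diff cong_mult) (auto simp: cong_def)
  then have "[a ^ (2 * e + fst dq) = x * x * a ^ fst dq - snd dq * n] (mod n)"
    by (simp add: power_add mult_2)
  then show ?case using Cons.IH Cons.prems(1) by simp
qed simp

text \<open>Transfer of Pocklington's criterion to \<open>int\<close>, where the chains subtract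
  multiples of \<open>n\<close>. The condition \<open>b \<ge> 1\<close> keeps \<open>b - 1\<close>
  from being truncated on the way back to \<open>nat\<close>.\<close>

lemma pocklington_int:
  fixes n q :: int and a r :: nat
  assumes n: "n = q * int r + 1" "n \<le> q\<^sup>2" and "1 < q" "0 < r"
    and fermat: "[int a ^ nat (n - 1) = 1] (mod n)"
    and factors: "\<And>p. prime p \<Longrightarrow> p dvd q \<Longrightarrow>
      \<exists>b\<ge>1. [int a ^ nat ((n - 1) div p) = b] (mod n) \<and> coprime (b - 1) n"
  shows "prime n"
proof -
  define Q M where "Q = nat q" and "M = nat n"
  have "1 < n" using \<open>1 < q\<close> \<open>0 < r\<close> by (simp add: n)
  have Q: "int Q = q" and M: "int M = n"
    using \<open>1 < q\<close> \<open>1 < n\<close> by (simp_all add: Q_def M_def)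
  have "int M = int (Q * r + 1)" using M Q n(1) by simp
  then have MQ: "M = Q * r + 1" by (simp only: of_nat_eq_iff)
  have "prime M"
  proof (rule pocklington_alt)
    show "2 \<le> M" using M \<open>1 < n\<close> by simp
    show "M - 1 = Q * r" using MQ by simp
    have "int M \<le> int (Q\<^sup>2)" using n(2) M Q by simp
    then show "M \<le> Q\<^sup>2" by (simp only: of_nat_le_iff)
    have "[int (a ^ (M - 1)) = int 1] (mod int M)"
      using fermat \<open>1 < n\<close> by (simp add: M_def nat_diff_distrib)
    then show "[a ^ (M - 1) = 1] (mod M)" by (simp only: cong_int_iff)
    show "\<forall>p. prime p \<and> p dvd Q \<longrightarrow> (\<exists>b. [a ^ ((M - 1) div p) = b] (mod M) \<and> coprime (b - 1) M)"
    proof (intro allI impI)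
      fix p assume p: "prime p \<and> p dvd Q"
      then have "prime (int p)" "int p dvd q" using Q by auto
      then obtain b where b: "1 \<le> b" "[int a ^ nat ((n - 1) div int p) = b] (mod n)" "coprime (b - 1) n"
        using factors by blast
      have "(n - 1) div int p = int ((M - 1) div p)"
        using M \<open>1 < n\<close> by (simp add: of_nat_diff zdiv_int)
      then have "[int (a ^ ((M - 1) div p)) = int (nat b)] (mod int M)"
        using b(1,2) M by simp
      then have "[a ^ ((M - 1) div p) = nat b] (mod M)" by (simp only: cong_int_iff)
      moreover have "coprime (int (nat b - 1)) (int M)"
        using b(1,3) M by (simp add: of_nat_diff)
      then have "coprime (nat b - 1) M" by simp
      ultimately show "\<exists>b. [a ^ ((M - 1) div p) = b] (mod M) \<and> coprime (b - 1) M" by blast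
    qed
  qed
  then show ?thesis using M by (metis prime_nat_int_transfer)
qed

text \<open>A Bezout identity, so that no gcd has to be computed.\<close>

lemma coprime_witness: "coprime (x :: int) n" if "x * u - w * n = 1"
proof (rule coprimeI)
  fix c assume "c dvd x" "c dvd n"
  then have "c dvd x * u - w * n" by (intro dvd_diff dvd_mult dvd_mult2)
  then show "is_unit c" by (simp add: that)
qed

text \<open>For a prime factor \<open>p\<close> of \<open>n - 1\<close> with
  \<open>n \<le> p\<^sup>2\<close>: the chain \<open>ws\<close> certifies the Fermat condition, and
  \<open>vs\<close>, with exponent \<open>r = (n - 1) div p\<close>, the coprimality
  condition.\<close>

lemma pocklington_single_prime:
  fixes n p b u w :: int and a e r :: nat
  assumes p: "prime p" and n: "n = p * int r + 1" "n \<le> p\<^sup>2" and r: "0 < r"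
    and ws: "squaring_chain n (int a) (0, 1) ws = (e, 1)" "int e = n - 1"
    and vs: "squaring_chain n (int a) (0, 1) vs = (r, b)" "1 \<le> b" "(b - 1) * u - w * n = 1"
  shows "prime n"
proof (rule pocklington_int [OF n _ r])
  show "1 < p" using p by (rule prime_gt_1_int)
  have "nat (n - 1) = e" using ws(2) by linarith
  then show "[int a ^ nat (n - 1) = 1] (mod n)"
    using squaring_chain_cong [OF ws(1)] by simp
  fix p' assume "prime p'" "p' dvd p"
  then have "p' = p" using p by (simp add: primes_dvd_imp_eq)
  then have "nat ((n - 1) div p') = r" using n(1) \<open>1 < p\<close> by simp
  then show "\<exists>b\<ge>1. [int a ^ nat ((n - 1) div p') = b] (mod n) \<and> coprime (b - 1) n"
    using squaring_chain_cong [OF vs(1)] vs(2) coprime_witness [OF vs(3)] by auto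
qed

text \<open>For \<open>n - 1\<close> whose prime factors are individually too small: the product of
  two of them has to reach the square root of \<open>n\<close>.\<close>

lemma pocklington_two_primes:
  fixes n p1 p2 b1 b2 u1 u2 w1 w2 :: int and a e r r1 r2 :: nat
  assumes p: "prime p1" "prime p2" and n: "n = p1 * p2 * int r + 1" "n \<le> (p1 * p2)\<^sup>2" and r: "0 < r"
    and ws: "squaring_chain n (int a) (0, 1) ws = (e, 1)" "int e = n - 1"
    and vs1: "squaring_chain n (int a) (0, 1) vs1 = (r1, b1)" "int r1 = p2 * int r"
      "1 \<le> b1" "(b1 - 1) * u1 - w1 * n = 1"
    and vs2: "squaring_chain n (int a) (0, 1) vs2 = (r2, b2)" "int r2 = p1 * int r"
      "1 \<le> b2" "(b2 - 1) * u2 - w2 * n = 1"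
  shows "prime n"
proof (rule pocklington_int [OF n _ r])
  have gt: "1 < p1" "1 < p2" using p by (auto intro: prime_gt_1_int)
  then show "1 < p1 * p2" by (metis less_1_mult)
  have "nat (n - 1) = e" using ws(2) by linarith
  then show "[int a ^ nat (n - 1) = 1] (mod n)"
    using squaring_chain_cong [OF ws(1)] by simp
  fix p' assume "prime p'" "p' dvd p1 * p2"
  then have "p' = p1 \<or> p' = p2"
    using p by (metis prime_dvd_multD primes_dvd_imp_eq)
  moreover have "(n - 1) div p1 = int r1" "(n - 1) div p2 = int r2"
    using gt by (simp_all add: n(1) vs1(2) vs2(2))
  ultimately show "\<exists>b\<ge>1. [int a ^ nat ((n - 1) div p') = b] (mod n) \<and> coprime (b - 1) n"
    using squaring_chain_cong [OF vs1(1)] vs1(3) coprime_witness [OF vs1(4)]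
      squaring_chain_cong [OF vs2(1)] vs2(3) coprime_witness [OF vs2(4)] by auto
qed

lemma prime_by_trial_division:
  assumes "1 < n" "n < s * s" "\<forall>d\<in>set [2..<s]. \<not> d dvd n"
  shows "prime (n :: nat)"
proof -
  have "d = 1" if "d dvd n" "d\<^sup>2 \<le> n" for d
  proof (rule ccontr)
    assume "d \<noteq> 1"
    moreover have "d \<noteq> 0" using that(1) assms(1) by (cases "d = 0") auto
    moreover have "d < s"
      using that(2) assms(2) by (metis le_less_trans not_less power2_eq_square mult_le_mono)
    ultimately show False using assms(3) that(1) by auto
  qed
  then show ?thesis using assms(1) by (auto simp: prime_divisor_sqrt)
qed

section \<open>Prime values and minimality for the individual spins\<close>

lemma prime_73: "prime (73 :: int)"
  by simp

lemma spin_poly_minimal_3: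
  fixes x :: real
  assumes "poly (of_int_poly (spin_poly 3)) x = 0" "q \<noteq> 0" "degree q < degree (spin_poly 3)"
  shows "poly (of_int_poly q) x \<noteq> 0"
proof (rule no_lower_degree_annihilator_scaled [OF assms(1) _ _ _ _ _ _ _ assms(2,3)])
  \<comment> \<open>Replacing \<open>x\<close> by \<open>x / 4\<close> makes the polynomial monic;
    its value at 9 is \<open>-73\<close>.\<close>
  let ?Q = "[:-181, 120, -21, 1:] :: int poly"
  show "pcompose ?Q [:0, 4:] = smult 1 (spin_poly 3)"
    by (simp add: spin_poly_def)
  show "prime (73 :: int)" by (rule prime_73)
  show "\<bar>poly ?Q (9)\<bar> = 1 * 73" by simp
  show "poly (map_poly abs (pcompose ?Q [:9, 1:] * pcompose ?Q [:9, -1:])) 1 < 2 * \<bar>poly ?Q (9) * poly ?Q (9)\<bar>"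
    by (simp add: map_poly_pCons)
qed simp_all

lemma prime_67: "prime (67 :: int)"
  by simp

lemma prime_2011: "prime (2011 :: int)"
proof (rule pocklington_single_prime [OF prime_67, where r = 30])
  \<comment> \<open>The first components are the binary digits of 2010, most significant first. The
    last squaring is that of \<open>2010 = - 1\<close> modulo 2011.\<close>
  show "squaring_chain 2011 (int 2) (0, 1)
    [(1, 0), (1, 0), (1, 0), (1, 16), (1, 348), (0, 601), (1, 1918), (1, 2370), (0, 1614), (1, 2090),
      (0, 2009)] = (2010, 1)"
    by simp
  show "squaring_chain 2011 (int 2) (0, 1)
    [(1, 0), (1, 0), (1, 0), (1, 16), (0, 174)] = (30, 550)"
    by simp
  show "(550 - 1) * 337 - 92 * 2011 = (1 :: int)"
    by simp
qed simp_all

lemma spin_poly_minimal_4: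
  fixes x :: real
  assumes "poly (of_int_poly (spin_poly 4)) x = 0" "q \<noteq> 0" "degree q < degree (spin_poly 4)"
  shows "poly (of_int_poly q) x \<noteq> 0"
proof (rule no_lower_degree_annihilator_scaled [OF assms(1) _ _ _ _ _ _ _ assms(2,3)])
  let ?Q = "[:-12974, 3351, -222, 4:] :: int poly"
  show "pcompose ?Q [:0, 8:] = smult 2 (spin_poly 4)"
    by (simp add: spin_poly_def)
  show "prime (2011 :: int)" by (rule prime_2011)
  show "\<bar>poly ?Q (19)\<bar> = 1 * 2011" by simp
  show "poly (map_poly abs (pcompose ?Q [:19, 1:] * pcompose ?Q [:19, -1:])) 1 < 2 * \<bar>poly ?Q (19) * poly ?Q (19)\<bar>"
    by (simp add: map_poly_pCons)
qed simp_all

text \<open>Start of the ladder 409, 1637, 2583187, 4029771721, in which each prime divides its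
  successor minus 1.\<close>

lemma prime_409: "prime (409 :: int)"
proof -
  have "prime (409 :: nat)"
    by (rule prime_by_trial_division [where s = 21]) (simp_all add: upt_conv_Cons del: prime_nat_numeral_eq)
  then show ?thesis by (metis of_nat_numeral prime_nat_int_transfer)
qed

lemma prime_1637: "prime (1637 :: int)"
proof (rule pocklington_single_prime [OF prime_409, where r = 4])
  show "squaring_chain 1637 (int 2) (0, 1)
    [(1, 0), (1, 0), (0, 0), (0, 2), (1, 825), (1, 868), (0, 89), (0, 32), (1, 1166), (0, 60), (0, 1635)] = (1636, 1)"
    by simp
  show "squaring_chain 1637 (int 2) (0, 1)
    [(1, 0), (0, 0), (0, 0)] = (4, 16)"
    by simp
  show "(16 - 1) * 764 - 7 * 1637 = (1 :: int)"
    by simp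
qed simp_all

lemma prime_2583187: "prime (2583187 :: int)"
proof (rule pocklington_single_prime [OF prime_1637, where r = 1578])
  show "squaring_chain 2583187 (int 2) (0, 1)
    [(1, 0), (0, 0), (0, 0), (1, 0), (1, 0), (1, 212820), (0, 1481921), (1, 796188), (1, 2600505),
      (0, 2482166), (1, 1039815), (0, 950727), (1, 35040), (0, 1175707), (1, 2974890), (0, 44365), (0, 262696),
      (1, 4735826), (0, 713805), (0, 145687), (1, 5001978), (0, 2583185)] = (2583186, 1)"
    by simp
  show "squaring_chain 2583187 (int 2) (0, 1)
    [(1, 0), (1, 0), (0, 0), (0, 0), (0, 6), (1, 1264735), (0, 912408), (1, 1644114), (0, 1741935),
      (1, 15339), (0, 73137)] = (1578, 160030)"
    by simp
  show "(160030 - 1) * 568408 - 35213 * 2583187 = (1 :: int)"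
    by simp
qed simp_all

lemma prime_4029771721: "prime (4029771721 :: int)"
proof (rule pocklington_single_prime [OF prime_2583187, where r = 1560])
  show "squaring_chain 4029771721 (int 2) (0, 1)
    [(1, 0), (1, 0), (1, 0), (1, 0), (0, 0), (0, 286100946), (0, 2330747262), (0, 3488554143), (0, 12855790),
      (0, 3706799852), (1, 1111444853), (1, 377888531), (0, 2082609915), (0, 3320783859), (0, 224339097),
      (1, 6919077865), (0, 658130684), (1, 149219590), (1, 988549931), (0, 896037915), (1, 4147965964),
      (1, 3814383409), (1, 7067323184), (1, 2519546969), (1, 6579235335), (1, 19557731), (0, 178005585),
      (0, 1588768930), (1, 2012704901), (0, 4025409801), (0, 4029771719), (0, 0)] = (4029771720, 1)"
    by simp
  show "squaring_chain 4029771721 (int 2) (0, 1)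
    [(1, 0), (1, 0), (0, 0), (0, 0), (0, 0), (0, 69848), (1, 6015793083), (1, 7771010878), (0, 83978395),
      (0, 413716192), (0, 2076628574)] = (1560, 107376707)"
    by simp
  show "(107376707 - 1) * 3564852513 - 94988537 * 4029771721 = (1 :: int)"
    by simp
qed simp_all

lemma spin_poly_minimal_5:
  fixes x :: real
  assumes "poly (of_int_poly (spin_poly 5)) x = 0" "q \<noteq> 0" "degree q < degree (spin_poly 5)"
  shows "poly (of_int_poly q) x \<noteq> 0"
proof (rule no_lower_degree_annihilator_scaled [OF assms(1) _ _ _ _ _ _ _ assms(2,3)])
  let ?Q = "[:-124179359670272, 10907915693056, -367810790784, 6325467536, -60497344, 323112, -896, 1:] :: int poly"
  show "pcompose ?Q [:0, 32:] = smult 8192 (spin_poly 5)"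
    by (simp add: spin_poly_def)
  show "prime (4029771721 :: int)" by (rule prime_4029771721)
  show "\<bar>poly ?Q (79)\<bar> = 1 * 4029771721" by simp
  show "poly (map_poly abs (pcompose ?Q [:79, 1:] * pcompose ?Q [:79, -1:])) 1 < 2 * \<bar>poly ?Q (79) * poly ?Q (79)\<bar>"
    by (simp add: map_poly_pCons)
qed simp_all

lemma prime_13: "prime (13 :: int)"
  by simp

lemma prime_83617: "prime (83617 :: int)"
proof (rule pocklington_two_primes [OF prime_67 prime_13, where r = 96])
  show "squaring_chain 83617 (int 2) (0, 1)
    [(1, 0), (0, 0), (1, 0), (0, 0), (0, 12), (0, 24403), (1, 369), (1, 162027), (0, 2476), (1, 101644),
      (0, 24318), (1, 119320), (0, 2134), (0, 31011), (0, 129), (0, 83615), (0, 0)] = (83616, 1)"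
    by simp
  show "squaring_chain 83617 (int 2) (0, 1)
    [(1, 0), (0, 0), (0, 0), (1, 0), (1, 6), (1, 12201), (0, 22916), (0, 83289), (0, 8651), (0, 6974),
      (0, 10227)] = (1248, 1990)"
    by simp
  show "squaring_chain 83617 (int 2) (0, 1)
    [(1, 0), (1, 0), (0, 0), (0, 0), (1, 401), (0, 6897), (0, 2269), (1, 62708), (0, 18737), (0, 107),
      (0, 6329), (0, 49051), (0, 840)] = (6432, 19644)"
    by simp
  show "(1990 - 1) * 17993 - 428 * 83617 = (1 :: int)"
    by simp
  show "(19644 - 1) * 5917 - 1390 * 83617 = (1 :: int)"
    by simp
qed simp_all

lemma prime_368583737: "prime (368583737 :: int)"
proof (rule pocklington_single_prime [OF prime_83617, where r = 4408])
  show "squaring_chain 368583737 (int 2) (0, 1)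
    [(1, 0), (0, 0), (1, 0), (0, 0), (1, 0), (1, 23864), (1, 240943602), (1, 234096063), (1, 153969766),
      (1, 5737374), (0, 1620638), (0, 184127259), (0, 291273187), (0, 21441186), (0, 16341909), (1, 200050847),
      (0, 88774249), (0, 48630191), (1, 436109521), (0, 181484798), (0, 18205844), (0, 286600172),
      (0, 285352889), (1, 526957054), (1, 433606), (1, 370371536), (0, 368583735), (0, 0), (0, 0)] = (368583736, 1)"
    by simp
  show "squaring_chain 368583737 (int 2) (0, 1)
    [(1, 0), (0, 0), (0, 0), (0, 0), (1, 0), (0, 46), (0, 137371164), (1, 252010846), (1, 230303565),
      (1, 7628685), (0, 12076094), (0, 64945596), (0, 106232594)] = (4408, 227627271)"
    by simp
  show "(227627271 - 1) * 138339860 - 85434927 * 368583737 = (1 :: int)"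
    by simp
qed simp_all

lemma spin_poly_minimal_6:
  fixes x :: real
  assumes "poly (of_int_poly (spin_poly 6)) x = 0" "q \<noteq> 0" "degree q < degree (spin_poly 6)"
  shows "poly (of_int_poly q) x \<noteq> 0"
proof (rule no_lower_degree_annihilator_scaled [OF assms(1) _ _ _ _ _ _ _ assms(2,3)])
  let ?Q = "[:4717411992, -2397898539, 427335408, -35927680, 1531920, -31872, 256:] :: int poly"
  show "pcompose ?Q [:0, 4:] = smult 4 (spin_poly 6)"
    by (simp add: spin_poly_def)
  show "prime (368583737 :: int)" by (rule prime_368583737)
  show "\<bar>poly ?Q (29)\<bar> = 1 * 368583737" by simp
  show "poly (map_poly abs (pcompose ?Q [:29, 1:] * pcompose ?Q [:29, -1:])) 1 < 2 * \<bar>poly ?Q (29) * poly ?Q (29)\<bar>"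
    by (simp add: map_poly_pCons)
qed simp_all

lemma prime_131: "prime (131 :: int)"
  by simp

lemma prime_19: "prime (19 :: int)"
  by simp

lemma prime_109517: "prime (109517 :: int)"
proof (rule pocklington_two_primes [OF prime_131 prime_19, where r = 44])
  show "squaring_chain 109517 (int 2) (0, 1)
    [(1, 0), (1, 0), (0, 0), (1, 0), (0, 612), (1, 130271), (0, 80841), (1, 15201), (1, 212578), (1, 17477),
      (1, 34688), (0, 8262), (0, 86392), (1, 66261), (1, 37732), (0, 3160), (0, 109515)] = (109516, 1)"
    by simp
  show "squaring_chain 109517 (int 2) (0, 1)
    [(1, 0), (1, 0), (0, 0), (1, 0), (0, 612), (0, 65135), (0, 94636), (1, 950), (0, 1685), (0, 86977)] = (836, 104692)"
    by simp
  show "squaring_chain 109517 (int 2) (0, 1)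
    [(1, 0), (0, 0), (1, 0), (1, 0), (0, 38), (1, 19477), (0, 6814), (0, 56875), (0, 33481), (0, 21247),
      (1, 159384), (0, 62358), (0, 107520)] = (5764, 20356)"
    by simp
  show "(104692 - 1) * 105228 - 100591 * 109517 = (1 :: int)"
    by simp
  show "(20356 - 1) * 53061 - 9862 * 109517 = (1 :: int)"
    by simp
qed simp_all

lemma prime_9856531: "prime (9856531 :: int)"
proof (rule pocklington_single_prime [OF prime_109517, where r = 90])
  show "squaring_chain 9856531 (int 2) (0, 1)
    [(1, 0), (0, 0), (0, 0), (1, 0), (0, 0), (1, 13943), (1, 17707667), (0, 4110376), (0, 1614024),
      (1, 5230258), (1, 1977219), (0, 928695), (0, 3359132), (1, 750104), (1, 3576775), (0, 8783882),
      (0, 8686099), (0, 1193169), (0, 780067), (1, 2568356), (0, 1794824), (0, 19441), (1, 7291008),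
      (0, 9856529)] = (9856530, 1)"
    by simp
  show "squaring_chain 9856531 (int 2) (0, 1)
    [(1, 0), (0, 0), (1, 0), (1, 0), (0, 0), (1, 3569650), (0, 3905844)] = (90, 6253960)"
    by simp
  show "(6253960 - 1) * 9285181 - 5891438 * 9856531 = (1 :: int)"
    by simp
qed simp_all

lemma prime_92226535487777: "prime (92226535487777 :: int)"
proof (rule pocklington_single_prime [OF prime_9856531, where r = 9356896])
  show "squaring_chain 92226535487777 (int 2) (0, 1)
    [(1, 0), (0, 0), (1, 0), (0, 0), (0, 0), (1, 0), (1, 104865768900), (1, 1444573720496),
      (1, 4613571538301), (1, 56747095120410), (0, 71116647823125), (0, 716016919306), (0, 21957503901248),
      (0, 7188540975889), (1, 71096057555615), (0, 11799745897794), (0, 15053938172677), (1, 1427152465737),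
      (0, 949096872110), (1, 119539352288392), (0, 40371347976767), (0, 81169801895653), (1, 12803299336359),
      (1, 116901996621860), (1, 547773213302), (1, 87005694195940), (0, 78942112431372), (0, 13524910054901),
      (0, 67992924343694), (1, 48469065527069), (0, 71620890125899), (1, 140050397045), (1, 6120702146487),
      (1, 38802760818461), (1, 3677434735140), (1, 61905736628592), (0, 91134627040417), (0, 19484086458949),
      (1, 886471326), (0, 72536541203766), (0, 77046233676070), (1, 330878170285), (0, 661756340569),
      (0, 92226535487775), (0, 0), (0, 0), (0, 0)] = (92226535487776, 1)"
    by simp
  show "squaring_chain 92226535487777 (int 2) (0, 1)
    [(1, 0), (0, 0), (0, 0), (0, 0), (1, 0), (1, 0), (1, 25601994), (0, 11977351364987), (1, 5272158102071),
      (1, 155696797679267), (0, 29486830643739), (0, 1620207156061), (0, 7827029883606), (1, 96756990438843),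
      (1, 39719568610308), (0, 4973147345143), (0, 54947944520457), (1, 17069429035869), (1, 11036574154196),
      (0, 3335843284288), (0, 49459476198910), (0, 2241784744550), (0, 35202459785828), (0, 34776132178551)] = (9356896, 90423171613609)"
    by simp
  show "(90423171613609 - 1) * 30030052899084 - 29442856250623 * 92226535487777 = (1 :: int)"
    by simp
qed simp_all

lemma prime_483635952097902589: "prime (483635952097902589 :: int)"
proof (rule pocklington_single_prime [OF prime_92226535487777, where r = 5244])
  show "squaring_chain 483635952097902589 (int 2) (0, 1)
    [(1, 0), (1, 0), (0, 0), (1, 0), (0, 0), (1, 0), (1, 335498790206496), (0, 77562194498422407),
      (1, 319775835328576), (1, 16667192850383), (0, 3710289436700084), (0, 55434407135924529),
      (0, 2592164726475094), (1, 688276963577346503), (1, 15218635924304316), (1, 49773229477977342),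
      (0, 54511041969507363), (0, 35490534423143473), (0, 153491870909575056), (0, 41268745334576921),
      (1, 3260815213945014), (0, 47798317906348214), (1, 38990387579091328), (0, 59136574371549897),
      (1, 17280974029173606), (1, 271427839318646803), (0, 26431406596067384), (0, 19245400223683767),
      (0, 200225944589380786), (0, 100117831835115080), (0, 190749942179146740), (0, 8957347756651342),
      (1, 575696403914737338), (0, 8332095026616229), (1, 881105920460288188), (0, 4244951103599006),
      (1, 19987804095805393), (1, 641485576054796871), (0, 251194997736981746), (0, 152955859550891922),
      (1, 308018708294054233), (1, 183998032751065835), (1, 408383809303454455), (0, 61800319361987887),
      (0, 199026958979387412), (1, 2811063400094768), (1, 1146513229847), (1, 832032522730319861),
      (1, 247465087989858351), (1, 707080704368867379), (1, 689362853775007334), (1, 343150459240129527),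
      (1, 469082575112830924), (1, 641678044160890205), (1, 642913328494369594), (1, 417560302408331067),
      (1, 145630235286084149), (0, 291260470572168297), (0, 483635952097902587)] = (483635952097902588, 1)"
    by simp
  show "squaring_chain 483635952097902589 (int 2) (0, 1)
    [(1, 0), (0, 0), (1, 0), (0, 0), (0, 0), (0, 0), (1, 4999321), (1, 296022886424829032),
      (1, 375785390147985285), (1, 45132899816488558), (1, 821931474227406032), (0, 192203631225004267),
      (0, 189864079038354)] = (5244, 223445147587051063)"
    by simp
  show "(223445147587051063 - 1) * 373103748544381300 - 172378049640745091 * 483635952097902589 = (1 :: int)"
    by simp
qed simp_all

lemma prime_4139923749958046161841: "prime (4139923749958046161841 :: int)"
proof (rule pocklington_single_prime [OF prime_483635952097902589, where r = 8560])
  show "squaring_chain 4139923749958046161841 (int 2) (0, 1)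
    [(1, 0), (1, 0), (1, 0), (0, 0), (0, 0), (0, 0), (0, 1254201084884), (0, 40324403852918464434),
      (0, 223967714442050591252), (1, 2486245735995751160798), (1, 2129798520852046493165),
      (0, 404920287370989567163), (1, 3963082814428236788062), (1, 1230733028900144988333),
      (0, 547155149868752023565), (0, 276248092977360147791), (1, 3684043721184433721758),
      (1, 6558910672640325714415), (1, 2127732091785792864276), (1, 1489695243389162457662),
      (1, 973685355399191019639), (0, 2259780900658079680711), (1, 3611210485737802942939),
      (1, 2640311560826309031372), (1, 584987213572022070894), (0, 810857202860043604761),
      (1, 2214575113288128447918), (1, 2328659103636009576441), (1, 7751109632850113658689),
      (1, 304273549849176926684), (0, 2711294465133569967564), (0, 1033530322345253149065),
      (0, 1749511336560690374866), (1, 3608351554648967789388), (0, 2579353679722551000787),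
      (1, 786631780790884897299), (0, 3613557417825795395571), (1, 8240800901847776757618),
      (0, 1825860096531632047767), (0, 223285286758705259935), (1, 5941484557377499617575),
      (0, 94026315244667823876), (1, 2108095060732886881282), (0, 2917944258888024978036),
      (1, 3852254803746716283936), (1, 11618893477296108638), (0, 153686030400470913052),
      (0, 425856020462697395822), (0, 770085424439022926438), (1, 2060974862210594514945),
      (1, 1274602821425015826668), (0, 1600514768813063453866), (1, 255485640063620402356),
      (0, 2179027844929542163038), (1, 4827877616892139555050), (1, 560496441936505995058),
      (1, 115122544181239839022), (0, 79638175238086637046), (0, 709281470859055548522),
      (1, 3005394716339929766251), (1, 6566744503189087785446), (0, 1265545040582402247149),
      (1, 5063562454309765862420), (1, 6151181465572586002425), (1, 7270777091673083087559),
      (0, 2231814534108545123521), (1, 3481505093644945961099), (1, 4622964176491767560843),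
      (0, 1058118143950073555121), (0, 4139923749958046161839), (0, 0), (0, 0)] = (4139923749958046161840, 1)"
    by simp
  show "squaring_chain 4139923749958046161841 (int 2) (0, 1)
    [(1, 0), (0, 0), (0, 0), (0, 0), (0, 0), (1, 0), (0, 0), (1, 2630250313566857342),
      (1, 6951608203433733128227), (1, 1092514477713730806792), (0, 2341768864187120845),
      (0, 803827488690963898111), (0, 3864274760474475694714), (0, 1853013473887439192275)] = (8560, 1276114493563014937601)"
    by simp
  show "(1276114493563014937601 - 1) * 2362132678435520655973 - 728117697023028453039 * 4139923749958046161841 = (1 :: int)"
    by simp
qed simp_all

lemma spin_poly_minimal_7:
  fixes x :: real
  assumes "poly (of_int_poly (spin_poly 7)) x = 0" "q \<noteq> 0" "degree q < degree (spin_poly 7)"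
  shows "poly (of_int_poly q) x \<noteq> 0"
proof (rule no_lower_degree_annihilator_scaled [OF assms(1) _ _ _ _ _ _ _ assms(2,3)])
  let ?Q = "[:-35518366155408015724380160, 6675488821793718606561280, -540223690923149664190464, 25245690182440767774720, -765380717785766111232, 15961525200497623296, -236191044967727104, 2516011158134656, -19328443622208, 105945119280, -403457568, 1012632, -1504, 1:] :: int poly"
  show "pcompose ?Q [:0, 16:] = smult 524288 (spin_poly 7)"
    by (simp add: spin_poly_def)
  show "prime (4139923749958046161841 :: int)" by (rule prime_4139923749958046161841)
  \<comment> \<open>The value is five times a prime, so the root-free disc must have radius 5
    instead of 1.\<close>
  show "\<bar>poly ?Q (99)\<bar> = 5 * 4139923749958046161841" by simp
  show "poly (map_poly abs (pcompose ?Q [:99, 1:] * pcompose ?Q [:99, -1:])) 5 < 2 * \<bar>poly ?Q (99) * poly ?Q (99)\<bar>"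
    by (simp add: map_poly_pCons)
qed simp_all

lemma prime_463: "prime (463 :: int)"
proof -
  have "prime (463 :: nat)"
    by (rule prime_by_trial_division [where s = 22]) (simp_all add: upt_conv_Cons del: prime_nat_numeral_eq)
  then show ?thesis by (metis of_nat_numeral prime_nat_int_transfer)
qed

lemma prime_682463: "prime (682463 :: int)"
proof (rule pocklington_two_primes [OF prime_463 prime_67, where r = 22])
  show "squaring_chain 682463 (int 2) (0, 1)
    [(1, 0), (0, 0), (1, 0), (0, 0), (0, 1), (1, 392808), (1, 827655), (0, 113607), (1, 72943), (0, 501522),
      (0, 261976), (1, 763246), (1, 893730), (1, 419195), (0, 413019), (1, 891104), (1, 83913), (1, 1025644),
      (1, 658777), (0, 0)] = (682462, 1)"
    by simp
  show "squaring_chain 682463 (int 2) (0, 1)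
    [(1, 0), (0, 0), (1, 0), (1, 0), (1, 12), (0, 58056), (0, 575632), (0, 549816), (0, 671168), (1, 20915),
      (0, 1080)] = (1474, 333985)"
    by simp
  show "squaring_chain 682463 (int 2) (0, 1)
    [(1, 0), (0, 0), (0, 0), (1, 0), (1, 0), (1, 805546), (1, 658676), (1, 1265790), (0, 217324), (0, 118943),
      (1, 1242490), (0, 22377), (1, 860413), (0, 600897)] = (10186, 417378)"
    by simp
  show "(333985 - 1) * 172040 - 84193 * 682463 = (1 :: int)"
    by simp
  show "(417378 - 1) * 524824 - 320969 * 682463 = (1 :: int)"
    by simp
qed simp_all

lemma prime_48594095453: "prime (48594095453 :: int)"
proof (rule pocklington_single_prime [OF prime_682463, where r = 71204])
  show "squaring_chain 48594095453 (int 2) (0, 1)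
    [(1, 0), (0, 0), (1, 0), (1, 0), (0, 0), (1, 724), (0, 103899927), (1, 9271015421), (0, 1905326667),
      (0, 18730085975), (0, 24361055844), (0, 61292756), (0, 187676079), (1, 3822527462), (1, 2193598362),
      (0, 3858945684), (1, 59801900481), (1, 582296661), (1, 50159466870), (1, 2091257962), (0, 182376317),
      (0, 29947902142), (0, 653318), (0, 252074548), (1, 91885081410), (1, 15804191255), (0, 2348465968),
      (1, 1817900146), (0, 35219036281), (1, 77509483368), (0, 208789338), (1, 7472601170), (1, 47691335251),
      (1, 49180159926), (0, 8683221316), (0, 48594095451)] = (48594095452, 1)"
    by simp
  show "squaring_chain 48594095453 (int 2) (0, 1)
    [(1, 0), (0, 0), (0, 0), (0, 0), (1, 0), (0, 0), (1, 12147480158), (1, 92588090134), (0, 21961798526),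
      (0, 5300717751), (0, 23160306984), (1, 25565277949), (0, 6473501836), (0, 32994726642), (1, 87354785),
      (0, 4281344044), (0, 2710493992)] = (71204, 27228014273)"
    by simp
  show "(27228014273 - 1) * 28865165084 - 16173593099 * 48594095453 = (1 :: int)"
    by simp
qed simp_all

lemma prime_120476619587277533: "prime (120476619587277533 :: int)"
proof (rule pocklington_single_prime [OF prime_48594095453, where r = 2479244])
  show "squaring_chain 120476619587277533 (int 2) (0, 1)
    [(1, 0), (1, 0), (0, 0), (1, 0), (0, 0), (1, 0), (1, 1346811334722642), (0, 108652340944368994),
      (0, 33616571368589366), (0, 5665799266748362), (0, 16839159546204439), (0, 12264631052947210),
      (0, 4732672170644754), (0, 7414847589468926), (1, 9087535008243421), (0, 6017708305743986),
      (0, 45071946523539749), (1, 185547930988517282), (1, 233135760668065458), (0, 8717946582165887),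
      (1, 5887214037872195), (1, 18452485025670193), (0, 71733789980437372), (0, 46826986954724322),
      (0, 104244280526877598), (1, 178466775826675330), (1, 159420657584220277), (1, 66788950594765987),
      (0, 97496534070945402), (0, 102429935201530412), (0, 35974137707583500), (1, 232091680189350742),
      (0, 65337038578380), (0, 48066953823628148), (0, 44503684501213500), (1, 1989913791479582),
      (1, 3433575171242415), (1, 129989973686256025), (1, 237698225146728786), (0, 22006708916737031),
      (1, 53732451768940981), (0, 13031841132728002), (1, 12097618649828620), (0, 52595355023494806),
      (1, 1620222243405828), (0, 515694855046636), (0, 16484663031557823), (1, 140241002923426867),
      (0, 45298093982485538), (1, 232492171936437166), (1, 128751188576244920), (0, 65375417615480084),
      (1, 198723146699099235), (1, 126653396257866926), (1, 215383420796949195), (0, 1433874743044521),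
      (0, 120476619587277531)] = (120476619587277532, 1)"
    by simp
  show "squaring_chain 120476619587277533 (int 2) (0, 1)
    [(1, 0), (0, 0), (0, 0), (1, 0), (0, 0), (1, 0), (1, 313578), (1, 217434570226367329),
      (0, 104081863915329493), (1, 185513023909315595), (0, 56342948398435942), (1, 102893615462287054),
      (0, 11388433571476293), (0, 113568834387070968), (1, 140247250129876458), (0, 88928436901385112),
      (0, 6158909787302329), (0, 45566113047034483), (1, 91952370715841494), (1, 186161154414503020),
      (0, 58906233534402695), (0, 21863019169495209)] = (2479244, 102867330899904564)"
    by simp
  show "(102867330899904564 - 1) * 20347071075172813 - 17373071225802446 * 120476619587277533 = (1 :: int)"
    by simp
qed simp_all

lemma spin_poly_minimal_8:
  fixes x :: real
  assumes "poly (of_int_poly (spin_poly 8)) x = 0" "q \<noteq> 0" "degree q < degree (spin_poly 8)"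
  shows "poly (of_int_poly q) x \<noteq> 0"
proof (rule no_lower_degree_annihilator_scaled [OF assms(1) _ _ _ _ _ _ _ assms(2,3)])
  let ?Q = "[:40922458646410811392, -10445122258835043392, 1058220856197191424, -57914832267046937, 1925592373130716, -41015233836720, 570737328704, -5153896672, 29058144, -92800, 128:] :: int poly"
  show "pcompose ?Q [:0, 8:] = smult 512 (spin_poly 8)"
    by (simp add: spin_poly_def)
  show "prime (120476619587277533 :: int)" by (rule prime_120476619587277533)
  show "\<bar>poly ?Q (81)\<bar> = 1 * 120476619587277533" by simp
  show "poly (map_poly abs (pcompose ?Q [:81, 1:] * pcompose ?Q [:81, -1:])) 1 < 2 * \<bar>poly ?Q (81) * poly ?Q (81)\<bar>"
    by (simp add: map_poly_pCons)
qed simp_all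

section \<open>The minimal variance sums\<close>

lemma spin_cases:
  fixes N :: nat
  assumes "N \<in> {1..8}"
  shows "N = 1 \<or> N = 2 \<or> N = 3 \<or> N = 4 \<or> N = 5 \<or> N = 6 \<or> N = 7 \<or> N = 8"
  using assms by (simp add: atLeastAtMost_iff) linarith

lemma spin_poly_root:
  assumes "N \<in> {1..8}"
  shows "poly (of_int_poly (spin_poly N)) (min_variance_sum N) = 0"
  using spin_cases [OF assms] min_variance_sum_root_1 min_variance_sum_root_2 min_variance_sum_root_3
    min_variance_sum_root_4 min_variance_sum_root_5 min_variance_sum_root_6 min_variance_sum_root_7
    min_variance_sum_root_8
  by (elim disjE) (simp_all add: spin_poly_def map_poly_pCons)

lemma poly_const_nonzero:
  fixes q :: "int poly" and x :: real
  assumes "q \<noteq> 0" "degree q = 0"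
  shows "poly (of_int_poly q) x \<noteq> 0"
  using assms by (auto elim!: degree_eq_zeroE)

lemma spin_poly_minimal:
  fixes x :: real
  assumes "N \<in> {1..8}" "poly (of_int_poly (spin_poly N)) x = 0" "q \<noteq> 0" "degree q < degree (spin_poly N)"
  shows "poly (of_int_poly q) x \<noteq> 0"
proof (cases "N \<le> 2")
  case True
  \<comment> \<open>The polynomial is linear, so only nonzero constants compete.\<close>
  then have "degree (spin_poly N) \<le> 1" by (auto simp: spin_poly_def)
  then show ?thesis using assms(3,4) by (intro poly_const_nonzero) auto
next
  case False
  then consider "N = 3" | "N = 4" | "N = 5" | "N = 6" | "N = 7" | "N = 8"
    using spin_cases [OF assms(1)] by auto
  then show ?thesis
    using assms(2-) spin_poly_minimal_3 spin_poly_minimal_4 spin_poly_minimal_5 spin_poly_minimal_6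
      spin_poly_minimal_7 spin_poly_minimal_8
    by cases blast+
qed

theorem mainTheorem3:
  shows
    "(\<forall>N\<in>{1..8}.
        (\<exists>\<rho>\<in>density_matrices (Suc N). variance_sum N \<rho> = min_variance_sum N \<and>
            (\<forall>\<sigma>\<in>density_matrices (Suc N). variance_sum N \<rho> \<le> variance_sum N \<sigma>)) \<and>
        poly (of_int_poly (spin_poly N)) (min_variance_sum N) = 0 \<and>
        (\<forall>q::int poly. q \<noteq> 0 \<and> degree q < degree (spin_poly N) \<longrightarrow>
            poly (of_int_poly q) (min_variance_sum N) \<noteq> 0)) \<and>
     min_variance_sum 1 = 1 / 4 \<and>
     min_variance_sum 2 = 7 / 16 \<and>
     \<bar>min_variance_sum 3 - 0.6009\<bar> < 5 / 10 ^ 5 \<and>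
     \<bar>min_variance_sum 4 - 0.7496\<bar> < 5 / 10 ^ 5 \<and>
     \<bar>min_variance_sum 5 - 0.8877\<bar> < 5 / 10 ^ 5 \<and>
     \<bar>min_variance_sum 6 - 1.018\<bar> < 5 / 10 ^ 4 \<and>
     \<bar>min_variance_sum 7 - 1.142\<bar> < 5 / 10 ^ 4 \<and>
     \<bar>min_variance_sum 8 - 1.260\<bar> < 5 / 10 ^ 4"
proof (intro conjI ballI allI impI)
  fix N :: nat assume N: "N \<in> {1..8}"
  show "\<exists>\<rho>\<in>density_matrices (Suc N). variance_sum N \<rho> = min_variance_sum N \<and>
      (\<forall>\<sigma>\<in>density_matrices (Suc N). variance_sum N \<rho> \<le> variance_sum N \<sigma>)"
    \<comment> \<open>The goal is the last fact that the elimination rule provides, so it serves as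
      its \<open>thesis\<close>.\<close>
    by (rule min_variance_sum_eq [of N])
  show "poly (of_int_poly (spin_poly N)) (min_variance_sum N) = 0"
    by (rule spin_poly_root [OF N])
  fix q :: "int poly" assume "q \<noteq> 0 \<and> degree q < degree (spin_poly N)"
  then show "poly (of_int_poly q) (min_variance_sum N) \<noteq> 0"
    using spin_poly_minimal [OF N spin_poly_root [OF N]] by blast
next
  show "min_variance_sum 1 = 1 / 4" using min_variance_sum_root_1 by simp
  show "min_variance_sum 2 = 7 / 16" using min_variance_sum_root_2 by simp
  show "\<bar>min_variance_sum 3 - 0.6009\<bar> < 5 / 10 ^ 5"
    using min_variance_sum_greater_3 min_variance_sum_less_3 unfolding abs_less_iff by simp
  show "\<bar>min_variance_sum 4 - 0.7496\<bar> < 5 / 10 ^ 5"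
    using min_variance_sum_greater_4 min_variance_sum_less_4 unfolding abs_less_iff by simp
  show "\<bar>min_variance_sum 5 - 0.8877\<bar> < 5 / 10 ^ 5"
    using min_variance_sum_greater_5 min_variance_sum_less_5 unfolding abs_less_iff by simp
  show "\<bar>min_variance_sum 6 - 1.018\<bar> < 5 / 10 ^ 4"
    using min_variance_sum_greater_6 min_variance_sum_less_6 unfolding abs_less_iff by simp
  show "\<bar>min_variance_sum 7 - 1.142\<bar> < 5 / 10 ^ 4"
    using min_variance_sum_greater_7 min_variance_sum_less_7 unfolding abs_less_iff by simp
  show "\<bar>min_variance_sum 8 - 1.260\<bar> < 5 / 10 ^ 4"
    using min_variance_sum_greater_8 min_variance_sum_less_8 unfolding abs_less_iff by simp
qed

end
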